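(* Let $G$ be a compressible Borel graph of finite maximum degree. If $G$ admits a Borel proper $k$-coloring (i.e., $\chi_{\mathrm{B}}(G)\leq k$), then $G$ has a Borel-equitable $k$-coloring.
   Context: A Borel graph has a standard Borel vertex set and Borel edge set. For Borel $A,B$, $A\approx_G B$ means there is a Borel bijection $\phi\colon A\to B$ with $\phi(x)$ in the same connected component as $x$. $[U]_G$ is the union of connected components meeting $U$. A Borel set $U$ is $G$-compressible if there is Borel $A\subseteq U$ with $[A]_G=[U]_G$ and $U\approx_G U\setminus A$; $G$ is compressible if $V(G)$ is $G$-compressible. A Borel-equitable $k$-coloring is a Borel proper $k$-coloring $f$ with $f^{-1}(\alpha)\approx_G f^{-1}(\beta)$ for all colors $\alpha,\beta$. *)

theory Defs
  imports "HOL-Analysis.Analysis"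
begin

text \<open>A Borel graph: vertex set V a Borel subset of a Polish space (hence a standard
Borel space), edge set E a symmetric irreflexive relation on V that is Borel in V \<times> V.\<close>

definition borel_graph :: "'a::polish_space set \<Rightarrow> ('a \<times> 'a) set \<Rightarrow> bool" where
  "borel_graph V E \<longleftrightarrow> V \<in> sets borel \<and> E \<subseteq> V \<times> V \<and> sym E \<and> irrefl E
     \<and> E \<in> sets (borel \<Otimes>\<^sub>M borel)"

definition same_comp :: "('a \<times> 'a) set \<Rightarrow> 'a \<Rightarrow> 'a \<Rightarrow> bool" where
  "same_comp E x y \<longleftrightarrow> (x, y) \<in> E\<^sup>*"

definition saturation :: "'a set \<Rightarrow> ('a \<times> 'a) set \<Rightarrow> 'a set \<Rightarrow> 'a set" where
  "saturation V E U = {y \<in> V. \<exists>x\<in>U. same_comp E x y}"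

definition borel_equidec :: "('a::polish_space \<times> 'a) set \<Rightarrow> 'a set \<Rightarrow> 'a set \<Rightarrow> bool" where
  "borel_equidec E A B \<longleftrightarrow> (\<exists>\<phi>. bij_betw \<phi> A B
      \<and> \<phi> \<in> measurable (restrict_space borel A) (restrict_space borel B)
      \<and> (\<forall>x\<in>A. same_comp E x (\<phi> x)))"

definition compressible_set :: "'a::polish_space set \<Rightarrow> ('a \<times> 'a) set \<Rightarrow> 'a set \<Rightarrow> bool" where
  "compressible_set V E U \<longleftrightarrow> (\<exists>A. A \<in> sets borel \<and> A \<subseteq> U
      \<and> saturation V E A = saturation V E U \<and> borel_equidec E U (U - A))"

definition compressible :: "'a::polish_space set \<Rightarrow> ('a \<times> 'a) set \<Rightarrow> bool" where
  "compressible V E \<longleftrightarrow> compressible_set V E V"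

definition finite_max_degree :: "'a set \<Rightarrow> ('a \<times> 'a) set \<Rightarrow> bool" where
  "finite_max_degree V E \<longleftrightarrow> (\<exists>d::nat. \<forall>x\<in>V. finite (E `` {x}) \<and> card (E `` {x}) \<le> d)"

definition borel_proper_coloring :: "'a::polish_space set \<Rightarrow> ('a \<times> 'a) set \<Rightarrow> nat \<Rightarrow> ('a \<Rightarrow> nat) \<Rightarrow> bool" where
  "borel_proper_coloring V E k f \<longleftrightarrow> f ` V \<subseteq> {..<k}
      \<and> f \<in> measurable (restrict_space borel V) (count_space UNIV)
      \<and> (\<forall>(x, y)\<in>E. f x \<noteq> f y)"

definition borel_equitable_coloring :: "'a::polish_space set \<Rightarrow> ('a \<times> 'a) set \<Rightarrow> nat \<Rightarrow> ('a \<Rightarrow> nat) \<Rightarrow> bool" where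
  "borel_equitable_coloring V E k f \<longleftrightarrow> borel_proper_coloring V E k f
      \<and> (\<forall>\<alpha><k. \<forall>\<beta><k. borel_equidec E {x \<in> V. f x = \<alpha>} {x \<in> V. f x = \<beta>})"

end

theory Submission
  imports Defs
begin

text \<open>
Call a Borel set \<open>U\<close> large if some Borel complete section \<open>S\<close> admits countably many Borel injections
into \<open>U\<close> along the components with pairwise disjoint ranges. Compressibility makes \<open>V\<close> large (iterate
the compression on its wandering set), a Schroeder--Bernstein argument makes every large set
equidecomposable with \<open>V\<close>, and by the infinite pigeonhole principle largeness passes from a set to any
set that absorbs it through finitely many partial injections. By the latter, after choosing one colour
per component in a Borel way, \<open>V\<close> contains a large independent set \<open>I\<close>, which splits into disjoint
large pieces \<open>C j\<close>. Give a point of \<open>C j\<close> colour \<open>j\<close> unless it already has a neighbour of that colour: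
the colouring stays proper, and colour class \<open>j\<close> meets the closed neighbourhood of every point of
\<open>C j\<close>, hence is large. Borelness of all projections involved rests on the Lusin--Souslin theorem.
\<close>

section \<open>The Lusin--Souslin theorem\<close>

text \<open>Compressibility need not pass to the parts of a finite partition, so it gives no direct
  hold on a colour class. Disjoint copies of a complete section are sturdier: if infinitely many
  copies of a point are spread over finitely many parts, some part receives infinitely many. Here
  the degree bound enters, as it turns a closed neighbourhood into finitely many partial injections.
  The part that wins may change with the component, so no single class of the given colouring need
  be large. Letting the colour vary by component still gives an independent set, because adjacent
  points share a component. Independence has two uses: neighbours of a recoloured point keep their
  old colours, and a point of \<open>C j\<close> that is refused colour \<open>j\<close> has a
  neighbour that keeps colour \<open>j\<close>. Hence each class owes its size to its own piece,
  whatever the other pieces do. The descriptive obstacle is that projections of Borel sets are in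
  general only analytic; relations are therefore cut into countably many pieces on which the
  projection is injective.\<close>

instance prod :: (polish_space, polish_space) polish_space ..

text \<open>The analytic (Suslin) sets, with real sequences as witnesses in place of Baire space:
  one sequence can store a natural number or countably many further sequences.\<close>

definition analytic_set :: "'a::polish_space set \<Rightarrow> bool" where
  "analytic_set B \<longleftrightarrow> (\<exists>F::((nat \<Rightarrow> real) \<times> 'a) set. closed F \<and> B = snd ` F)"

lemma analytic_set_closed: "closed B \<Longrightarrow> analytic_set B"
  unfolding analytic_set_def by (rule exI[of _ "UNIV \<times> B"]) (auto intro: closed_Times simp: image_iff)

text \<open>A countable union of closed sets need not be closed, so the index is stored in the
  witness. For a natural number, distance at least \<open>1/2\<close> from \<open>n\<close> just
  means being different from \<open>n\<close>, and this closed form keeps every clause of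
  \<open>K\<close> closed.\<close>

lemma analytic_set_UN:
  fixes B :: "nat \<Rightarrow> 'a::polish_space set"
  assumes "\<And>n. analytic_set (B n)"
  shows "analytic_set (\<Union>n. B n)"
proof -
  obtain F :: "nat \<Rightarrow> ((nat \<Rightarrow> real) \<times> 'a) set"
    where F: "\<And>n. closed (F n)" "\<And>n. B n = snd ` F n"
    using assms unfolding analytic_set_def by metis
  define t :: "(nat \<Rightarrow> real) \<times> 'a \<Rightarrow> (nat \<Rightarrow> real) \<times> 'a"
    where "t = (\<lambda>z. (\<lambda>i. fst z (Suc i), snd z))"
  have ct: "continuous_on UNIV t"
    unfolding t_def
    by (intro continuous_intros continuous_on_coordinatewise_then_product
        continuous_on_compose2[OF continuous_on_product_coordinates]) auto
  have c0: "continuous_on UNIV (\<lambda>z::(nat \<Rightarrow> real) \<times> 'a. fst z 0)"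
    by (intro continuous_intros continuous_on_compose2[OF continuous_on_product_coordinates]) auto
  \<comment> \<open>the sequence entry at \<open>0\<close> selects the member of the union, the others are its witness\<close>
  define K where "K = {z::(nat \<Rightarrow> real) \<times> 'a. fst z 0 \<in> \<nat>} \<inter> (\<Inter>n. {z. \<bar>fst z 0 - real n\<bar> \<ge> 1/2} \<union> t -` F n)"
  have "closed (\<nat> :: real set)"
    by (rule closed_subset_Ints) (auto elim: Nats_cases)
  then have "closed ((\<lambda>z::(nat \<Rightarrow> real) \<times> 'a. fst z 0) -` \<nat>)"
    using c0 continuous_closed_vimage by (metis continuous_on_eq_continuous_at open_UNIV UNIV_I)
  moreover have "closed (t -` F n)" for n
    using ct F(1) by (metis continuous_closed_vimage continuous_on_eq_continuous_at open_UNIV UNIV_I)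
  moreover have "closed {z::(nat \<Rightarrow> real) \<times> 'a. \<bar>fst z 0 - real n\<bar> \<ge> 1/2}" for n
    by (intro closed_Collect_le continuous_intros c0)
  ultimately have "closed K"
    unfolding K_def vimage_def by (intro closed_Int closed_INT ballI closed_Un) auto
  moreover have "(\<Union>n. B n) = snd ` K"
  proof (intro equalityI subsetI)
    fix x assume "x \<in> (\<Union>n. B n)"
    then obtain n r where "(r, x) \<in> F n" by (auto simp: F(2))
    define s where "s = (\<lambda>i. case i of 0 \<Rightarrow> real n | Suc j \<Rightarrow> r j)"
    have "t (s, x) = (r, x)" by (simp add: t_def s_def)
    moreover have "\<bar>real n - real m\<bar> \<ge> 1/2 \<or> m = n" for m by linarith
    moreover have "s 0 = real n" by (simp add: s_def)
    ultimately have "(s, x) \<in> K"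
      unfolding K_def using \<open>(r, x) \<in> F n\<close> by (fastforce simp del: of_nat_diff)
    then show "x \<in> snd ` K" by force
  next
    fix x assume "x \<in> snd ` K"
    then obtain s where s: "(s, x) \<in> K" by auto
    then obtain n where "s 0 = real n" by (auto simp: K_def elim: Nats_cases)
    then have "t (s, x) \<in> F n" using s by (auto simp: K_def dest: spec[of _ n])
    then show "x \<in> (\<Union>n. B n)" by (force simp: F(2) t_def)
  qed
  ultimately show ?thesis unfolding analytic_set_def by blast
qed

text \<open>Countably many witnesses for the same point are interleaved by
  \<open>prod_encode\<close> into a single sequence.\<close>

lemma analytic_set_INT:
  fixes B :: "nat \<Rightarrow> 'a::polish_space set"
  assumes "\<And>n. analytic_set (B n)"
  shows "analytic_set (\<Inter>n. B n)"
proof -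
  obtain F :: "nat \<Rightarrow> ((nat \<Rightarrow> real) \<times> 'a) set"
    where F: "\<And>n. closed (F n)" "\<And>n. B n = snd ` F n"
    using assms unfolding analytic_set_def by metis
  define t :: "nat \<Rightarrow> (nat \<Rightarrow> real) \<times> 'a \<Rightarrow> (nat \<Rightarrow> real) \<times> 'a"
    where "t = (\<lambda>n z. (\<lambda>i. fst z (prod_encode (n, i)), snd z))"
  have ct: "continuous_on UNIV (t n)" for n
    unfolding t_def
    by (intro continuous_intros continuous_on_coordinatewise_then_product
        continuous_on_compose2[OF continuous_on_product_coordinates]) auto
  have "closed (t n -` F n)" for n
    using ct F(1) by (metis continuous_closed_vimage continuous_on_eq_continuous_at open_UNIV UNIV_I)
  then have "closed (\<Inter>n. t n -` F n)" by auto
  moreover have "(\<Inter>n. B n) = snd ` (\<Inter>n. t n -` F n)"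
  proof (intro equalityI subsetI)
    fix x assume "x \<in> (\<Inter>n. B n)"
    then have "\<forall>n. \<exists>r. (r, x) \<in> F n" by (force simp: F(2))
    then obtain r where r: "\<And>n. (r n, x) \<in> F n" by metis
    have "t n (\<lambda>j. case prod_decode j of (n, i) \<Rightarrow> r n i, x) = (r n, x)" for n
      by (simp add: t_def)
    then have "(\<lambda>j. case prod_decode j of (n, i) \<Rightarrow> r n i, x) \<in> (\<Inter>n. t n -` F n)"
      using r by simp
    then show "x \<in> snd ` (\<Inter>n. t n -` F n)" by force
  next
    fix x assume "x \<in> snd ` (\<Inter>n. t n -` F n)"
    then obtain s where s: "(s, x) \<in> (\<Inter>n. t n -` F n)" by auto
    have "x \<in> B n" for n
    proof -
      have "t n (s, x) \<in> F n" using s by blast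
      then show ?thesis unfolding F(2) t_def by force
    qed
    then show "x \<in> (\<Inter>n. B n)" by blast
  qed
  ultimately show ?thesis unfolding analytic_set_def by blast
qed

lemma borel_imp_analytic_set:
  fixes B :: "'a::polish_space set"
  assumes "B \<in> sets borel"
  shows "analytic_set B"
proof -
  have "B \<in> sigma_sets UNIV {S. open S}"
    using assms by (simp add: borel_def)
  \<comment> \<open>Complements of analytic sets need not be analytic, so the induction carries a
    set together with its complement.\<close>
  then have "analytic_set B \<and> analytic_set (- B)"
  proof induction
    case (Basic S)
    then have "fsigma_in euclidean S"
      by (simp add: open_imp_fsigma_in metrizable_space_euclidean)
    then obtain C where "\<And>n. closed (C n)" "S = \<Union> (range (C :: nat \<Rightarrow> _))"
      unfolding fsigma_in_ascending by auto
    then have "analytic_set S" using analytic_set_UN[of C] analytic_set_closed by auto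
    then show ?case using Basic analytic_set_closed[of "- S"] by auto
  next
    case Empty
    then show ?case by (simp add: analytic_set_closed)
  next
    case (Compl S)
    then show ?case by (simp add: Compl_eq_Diff_UNIV[symmetric])
  next
    case (Union S)
    then show ?case using analytic_set_UN[of S] analytic_set_INT[of "\<lambda>n. - S n"]
      by (simp add: Compl_UN)
  qed
  then show ?thesis by simp
qed

section \<open>Lusin separation of disjoint analytic images\<close>

definition borel_separated :: "'b::topological_space set \<Rightarrow> 'b set \<Rightarrow> bool" where
  "borel_separated X Y \<longleftrightarrow> (\<exists>S\<in>sets borel. X \<subseteq> S \<and> Y \<inter> S = {})"

text \<open>Contrapositively, if two countable unions cannot be separated, then some pair of members
  cannot; this lets \<open>separation_step\<close> shrink both sets at once.\<close>

lemma borel_separated_UN: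
  fixes X Y :: "nat \<Rightarrow> 'b::topological_space set"
  assumes "\<And>i j. borel_separated (X i) (Y j)"
  shows "borel_separated (\<Union>i. X i) (\<Union>j. Y j)"
proof -
  obtain S where S: "\<And>i j. S i j \<in> sets borel" and S2: "\<And>i j. X i \<subseteq> S i j" and S3: "\<And>i j. Y j \<inter> S i j = {}"
    using assms unfolding borel_separated_def by metis
  have "(\<Inter>j. S i j) \<in> sets borel" for i
    by (rule sets.countable_INT'') (simp_all add: S)
  then have "(\<Union>i. \<Inter>j. S i j) \<in> sets borel"
    by (rule sets.countable_UN[OF image_subsetI])
  moreover have "(\<Union>i. X i) \<subseteq> (\<Union>i. \<Inter>j. S i j)" by (intro UN_mono INT_greatest) (simp_all add: S2)
  moreover have "(\<Union>j. Y j) \<inter> (\<Union>i. \<Inter>j. S i j) = {}" by (auto simp: disjoint_iff) (meson S3 disjoint_iff)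
  ultimately show ?thesis unfolding borel_separated_def by blast
qed

lemma small_closed_cover:
  fixes \<epsilon> :: real
  assumes "\<epsilon> > 0"
  obtains c :: "nat \<Rightarrow> 'a::{metric_space, second_countable_topology}"
  where "(\<Union>i. cball (c i) \<epsilon>) = UNIV"
proof -
  obtain D :: "'a set" where D: "countable D" "\<And>X. open X \<Longrightarrow> X \<noteq> {} \<Longrightarrow> \<exists>d\<in>D. d \<in> X"
    using countable_dense_setE by auto
  have "D \<noteq> {}" using D(2)[of UNIV] by auto
  have "x \<in> (\<Union>i. cball (from_nat_into D i) \<epsilon>)" for x
  proof -
    obtain d where "d \<in> D" "d \<in> ball x \<epsilon>" using D(2)[of "ball x \<epsilon>"] assms by auto
    then show ?thesis
      using from_nat_into_to_nat_on[OF D(1) \<open>d \<in> D\<close>]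
      by (auto simp: dist_commute intro!: exI[of _ "to_nat_on D d"])
  qed
  then show ?thesis by (intro that[of "from_nat_into D"]) auto
qed

lemma separation_step:
  fixes C D :: "'w::polish_space set" and q :: "'w \<Rightarrow> 'b::topological_space"
  assumes "\<not> borel_separated (q ` C) (q ` D)" "\<epsilon> > 0"
  shows "\<exists>a b. \<not> borel_separated (q ` (C \<inter> cball a \<epsilon>)) (q ` (D \<inter> cball b \<epsilon>))"
proof (rule ccontr)
  assume *: "\<not> ?thesis"
  obtain c :: "nat \<Rightarrow> 'w" where c: "(\<Union>i. cball (c i) \<epsilon>) = UNIV"
    using small_closed_cover[OF assms(2)] by blast
  have "borel_separated (\<Union>i. q ` (C \<inter> cball (c i) \<epsilon>)) (\<Union>i. q ` (D \<inter> cball (c i) \<epsilon>))"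
    using * by (intro borel_separated_UN) simp
  moreover have "(\<Union>i. q ` (C \<inter> cball (c i) \<epsilon>)) = q ` C" for C
  proof -
    have "(\<Union>i. C \<inter> cball (c i) \<epsilon>) = C" using c by blast
    then show ?thesis by (metis image_UN)
  qed
  ultimately show False using assms(1) by simp
qed

text \<open>Lusin's separation theorem. An inseparable pair contains inseparable pairs of ever
  smaller radius, which by completeness close in on points \<open>w\<close> and \<open>v\<close>.
  The images being disjoint, \<open>q w\<close> and \<open>q v\<close> differ, and disjoint
  neighbourhoods of them separate the small pieces after all.\<close>

lemma closed_images_borel_separated:
  fixes C D :: "'w::polish_space set" and q :: "'w \<Rightarrow> 'b::t2_space"
  assumes "closed C" "closed D" "continuous_on UNIV q" "q ` C \<inter> q ` D = {}"
  shows "borel_separated (q ` C) (q ` D)"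
proof (rule ccontr)
  assume nsep: "\<not> ?thesis"
  define P where "P = (\<lambda>(n::nat) (X :: 'w set, Y :: 'w set). closed X \<and> closed Y \<and> X \<subseteq> C \<and> Y \<subseteq> D
      \<and> \<not> borel_separated (q ` X) (q ` Y))"
  define Q where "Q = (\<lambda>(n::nat) (X :: 'w set, Y :: 'w set) (X', Y'). X' \<subseteq> X \<and> Y' \<subseteq> Y
      \<and> (\<exists>a b. X' \<subseteq> cball a (1 / Suc n) \<and> Y' \<subseteq> cball b (1 / Suc n)))"
  have "\<exists>Z'. P (Suc n) Z' \<and> Q n Z Z'" if PZ: "P n Z" for n Z
  proof -
    obtain X Y where Z: "Z = (X, Y)" by force
    obtain a b where "\<not> borel_separated (q ` (X \<inter> cball a (1 / Suc n))) (q ` (Y \<inter> cball b (1 / Suc n)))"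
      using separation_step[of q X Y "1 / Suc n"] PZ unfolding Z P_def by auto
    then have "P (Suc n) (X \<inter> cball a (1 / Suc n), Y \<inter> cball b (1 / Suc n))
        \<and> Q n Z (X \<inter> cball a (1 / Suc n), Y \<inter> cball b (1 / Suc n))"
      using PZ unfolding Z P_def Q_def by (auto intro!: closed_Int)
    then show ?thesis by blast
  qed
  moreover have "P 0 (C, D)" using assms nsep by (simp add: P_def)
  ultimately obtain Z where Z: "\<And>n. P n (Z n)" "\<And>n. Q n (Z n) (Z (Suc n))"
    using dependent_nat_choice[of P Q] by metis
  have lim: "\<exists>w. (\<forall>n. w \<in> S n) \<and> (\<forall>U. open U \<longrightarrow> q w \<in> U \<longrightarrow> (\<exists>N. \<forall>n\<ge>N. q ` S n \<subseteq> U))"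
    if cl: "\<And>n. closed (S n)" and ne: "\<And>n. S n \<noteq> {}" and dec: "\<And>n. S (Suc n) \<subseteq> S n"
      and small: "\<And>n. \<exists>a. S (Suc n) \<subseteq> cball a (1 / Suc n)" for S :: "nat \<Rightarrow> 'w set"
  proof -
    have anti: "S n \<subseteq> S m" if "m \<le> n" for m n
      using lift_Suc_antimono_le[of S, OF dec that] .
    have sm: "\<exists>N. \<forall>x\<in>S N. \<forall>y\<in>S N. dist x y < \<epsilon>" if "\<epsilon> > 0" for \<epsilon> :: real
    proof -
      have "0 < \<epsilon> / 2" using that by simp
      then obtain n where n: "1 / Suc n < \<epsilon> / 2" by (rule nat_approx_posE)
      obtain a where a: "S (Suc n) \<subseteq> cball a (1 / Suc n)" using small by blast
      have "dist x y < \<epsilon>" if "x \<in> S (Suc n)" "y \<in> S (Suc n)" for x y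
      proof -
        have "dist a x \<le> 1 / Suc n" "dist a y \<le> 1 / Suc n" using that a by auto
        then show ?thesis using n dist_triangle3[of x y a] by linarith
      qed
      then show ?thesis by blast
    qed
    obtain w where w: "\<And>n. w \<in> S n"
      using decreasing_closed_nest[of S] cl ne anti sm by metis
    have "\<exists>N. \<forall>n\<ge>N. q ` S n \<subseteq> U" if "open U" "q w \<in> U" for U
    proof -
      have "open (q -` U)"
        using assms(3) that(1) by (simp add: continuous_on_open_vimage)
      moreover have "w \<in> q -` U" using that(2) by simp
      ultimately obtain e where e: "e > 0" "\<And>y. dist y w < e \<Longrightarrow> y \<in> q -` U"
        unfolding open_dist by blast
      obtain N where "\<forall>x\<in>S N. \<forall>y\<in>S N. dist x y < e" using sm[OF e(1)] by blast
      then show ?thesis using w anti e(2) by (metis image_subsetI subsetD vimage_eq)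
    qed
    then show ?thesis using w by blast
  qed
  have props: "closed (fst (Z n))" "closed (snd (Z n))" "fst (Z n) \<subseteq> C" "snd (Z n) \<subseteq> D"
    "\<not> borel_separated (q ` fst (Z n)) (q ` snd (Z n))" for n
    using Z(1)[of n] by (auto simp: P_def split: prod.splits)
  \<comment> \<open>The empty set is separated from every set, so inseparable pieces are nonempty,
    as nested closed sets must be to have a common point.\<close>
  have "fst (Z n) \<noteq> {} \<and> snd (Z n) \<noteq> {}" for n
    using props(5)[of n] unfolding borel_separated_def
    by (metis image_is_empty empty_subsetI inf_bot_left inf_bot_right sets.empty_sets borel_open open_UNIV subset_UNIV)
  then have ne: "fst (Z n) \<noteq> {}" "snd (Z n) \<noteq> {}" for n by auto
  have dec: "fst (Z (Suc n)) \<subseteq> fst (Z n)" "snd (Z (Suc n)) \<subseteq> snd (Z n)"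
    "\<exists>a. fst (Z (Suc n)) \<subseteq> cball a (1 / Suc n)" "\<exists>a. snd (Z (Suc n)) \<subseteq> cball a (1 / Suc n)" for n
    using Z(2)[of n] by (auto simp: Q_def split: prod.splits)
  obtain w where w: "\<forall>n. w \<in> fst (Z n)"
    "\<And>U. open U \<Longrightarrow> q w \<in> U \<Longrightarrow> \<exists>N. \<forall>n\<ge>N. q ` fst (Z n) \<subseteq> U"
    using lim[of "\<lambda>n. fst (Z n)", OF props(1) ne(1) dec(1,3)] by blast
  obtain v where v: "\<forall>n. v \<in> snd (Z n)"
    "\<And>U. open U \<Longrightarrow> q v \<in> U \<Longrightarrow> \<exists>N. \<forall>n\<ge>N. q ` snd (Z n) \<subseteq> U"
    using lim[of "\<lambda>n. snd (Z n)", OF props(2) ne(2) dec(2,4)] by blast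
  have "q w \<noteq> q v" using assms(4) w(1) v(1) props(3,4)[of 0] by (metis disjoint_iff image_eqI subsetD)
  then obtain U U' where U: "open U" "open U'" "q w \<in> U" "q v \<in> U'" "U \<inter> U' = {}"
    using hausdorff by metis
  obtain N N' where "\<forall>n\<ge>N. q ` fst (Z n) \<subseteq> U" "\<forall>n\<ge>N'. q ` snd (Z n) \<subseteq> U'"
    using w(2)[OF U(1,3)] v(2)[OF U(2,4)] by blast
  then have "q ` fst (Z (max N N')) \<subseteq> U" "q ` snd (Z (max N N')) \<subseteq> U'" by auto
  then have "borel_separated (q ` fst (Z (max N N'))) (q ` snd (Z (max N N')))"
    unfolding borel_separated_def using U by (intro bexI[of _ U]) auto
  then show False using props(5) by simp
qed

text \<open>A Borel \<open>f\<close> need not be continuous, but its graph over \<open>C\<close> is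
  Borel, hence the projection of a closed set; the image of \<open>C\<close> is then a further
  projection of that closed set, and projections are continuous.\<close>

lemma borel_images_borel_separated:
  fixes f :: "'a::polish_space \<Rightarrow> 'b::polish_space"
  assumes f[measurable]: "f \<in> borel_measurable borel"
    and CD: "C \<in> sets borel" "D \<in> sets borel" and disj: "f ` C \<inter> f ` D = {}"
  shows "borel_separated (f ` C) (f ` D)"
proof -
  have "\<exists>F::((nat \<Rightarrow> real) \<times> 'a \<times> 'b) set. closed F \<and> f ` C = (\<lambda>z. snd (snd z)) ` F"
    if [measurable]: "C \<in> sets borel" for C
  proof -
    have "{z \<in> space (borel \<Otimes>\<^sub>M borel). f (fst z) = snd z \<and> fst z \<in> C} \<in> sets (borel \<Otimes>\<^sub>M borel)"
      by measurable
    then have "analytic_set {z. f (fst z) = snd z \<and> fst z \<in> C}"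
      unfolding borel_prod by (intro borel_imp_analytic_set) simp
    then obtain F :: "((nat \<Rightarrow> real) \<times> 'a \<times> 'b) set"
      where F: "closed F" "{z. f (fst z) = snd z \<and> fst z \<in> C} = snd ` F"
      unfolding analytic_set_def by blast
    have "f ` C = snd ` {z. f (fst z) = snd z \<and> fst z \<in> C}" by (auto simp: image_iff)
    then show ?thesis using F by (auto simp: image_image)
  qed
  from this[OF CD(1)] this[OF CD(2)] obtain F G :: "((nat \<Rightarrow> real) \<times> 'a \<times> 'b) set"
    where "closed F" "closed G" "f ` C = (\<lambda>z. snd (snd z)) ` F" "f ` D = (\<lambda>z. snd (snd z)) ` G"
    by blast
  then show ?thesis
    using closed_images_borel_separated[of F G "\<lambda>z. snd (snd z)"] disj
    by (simp add: continuous_on_snd)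
qed

text \<open>The inverse of \<open>f\<close>, defined on \<open>f ` B\<close> only, extends to a Borel map \<open>p\<close> on the whole space, because
the images under \<open>f\<close> of disjoint Borel subsets of \<open>B\<close> have Borel separations. Then \<open>f ` B\<close> consists of the
\<open>y\<close> with \<open>p y \<in> B\<close> and \<open>f (p y) = y\<close>.\<close>

lemma borel_inj_image:
  fixes f :: "'a::polish_space \<Rightarrow> 'b::polish_space"
  assumes f[measurable]: "f \<in> borel_measurable borel"
    and B[measurable]: "B \<in> sets borel" and inj: "inj_on f B"
  shows "f ` B \<in> sets borel"
proof -
  have "\<exists>c :: nat \<Rightarrow> 'a. (\<Union>i. cball (c i) (1 / Suc n)) = UNIV" for n
    using small_closed_cover[of "1 / Suc n"] by (metis of_nat_0_less_iff zero_less_Suc zero_less_divide_1_iff)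
  then obtain c :: "nat \<Rightarrow> nat \<Rightarrow> 'a" where c: "\<And>n. (\<Union>i. cball (c n i) (1 / Suc n)) = UNIV"
    by metis
  have "borel_separated (f ` (B \<inter> cball (c n i) (1 / Suc n))) (f ` (B - cball (c n i) (1 / Suc n)))" for n i
    using inj by (intro borel_images_borel_separated) (auto simp: inj_on_def)
  then obtain S where S[measurable]: "\<And>n i. S n i \<in> sets borel"
    and S1: "\<And>n i. f ` (B \<inter> cball (c n i) (1 / Suc n)) \<subseteq> S n i"
    and S2: "\<And>n i. f ` (B - cball (c n i) (1 / Suc n)) \<inter> S n i = {}"
    unfolding borel_separated_def by metis
  \<comment> \<open>The centre of the first ball whose separator contains \<open>y\<close>; at
    \<open>y = f x\<close> with \<open>x \<in> B\<close> this is the first ball that contains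
    \<open>x\<close>. Where no separator contains \<open>y\<close>, the \<open>LEAST\<close> is one
    fixed unspecified number, so \<open>h n\<close> is still Borel.\<close>
  define h where "h = (\<lambda>n y. c n (LEAST i. y \<in> S n i))"
  have h[measurable]: "h n \<in> borel_measurable borel" for n
    unfolding h_def by (rule measurable_compose[of _ _ "count_space UNIV"]) measurable
  define K where "K = {y. Cauchy (\<lambda>n. h n y)}"
  have K[measurable]: "K \<in> sets borel"
    using sets_Collect_Cauchy[of h borel] by (simp add: K_def)
  \<comment> \<open>Off \<open>K\<close> the sequence is replaced by a constant one, so that the
    pointwise limit exists everywhere and \<open>p\<close> is Borel on the whole space.\<close>
  define p where "p = (\<lambda>y. lim (\<lambda>n. if y \<in> K then h n y else c 0 0))"
  have "(\<lambda>n. if y \<in> K then h n y else c 0 0) \<longlonglongrightarrow> p y" for y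
    unfolding p_def by (cases "y \<in> K")
      (auto simp: K_def Cauchy_convergent_iff convergent_LIMSEQ_iff[symmetric])
  then have p[measurable]: "p \<in> borel_measurable borel"
    by (rule borel_measurable_LIMSEQ_metric[rotated]) measurable
  have pf: "p (f x) = x" if x: "x \<in> B" for x
  proof -
    have "dist (h n (f x)) x \<le> 1 / Suc n" for n
    proof -
      have *: "f x \<in> S n i \<longleftrightarrow> x \<in> cball (c n i) (1 / Suc n)" for i
        using S1[of n i] S2[of n i] x by blast
      have "\<exists>i. x \<in> cball (c n i) (1 / Suc n)" using c[of n] by blast
      then show ?thesis unfolding h_def * by (metis LeastI mem_cball)
    qed
    then have "(\<lambda>n. h n (f x)) \<longlonglongrightarrow> x"
      by (intro metric_LIMSEQ_I)
        (metis (no_types, lifting) inverse_eq_divide lim_inverse_n' LIMSEQ_Suc order.strict_trans1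
          order_tendstoD(2) eventually_sequentially of_nat_0_less_iff LIMSEQ_inverse_real_of_nat)
    then show ?thesis
      unfolding p_def K_def by (auto simp: LIMSEQ_imp_Cauchy limI)
  qed
  have "f ` B = {y \<in> space borel. p y \<in> B \<and> f (p y) = y}"
    using pf by (auto simp: image_iff) metis
  also have "\<dots> \<in> sets borel" by measurable
  finally show ?thesis .
qed

section \<open>Borel relations with bounded sections\<close>

lemma borel_basis_sequence:
  obtains U :: "nat \<Rightarrow> 'b::second_countable_topology set"
  where "\<And>n. open (U n)" "\<And>X x. open X \<Longrightarrow> x \<in> X \<Longrightarrow> \<exists>n. x \<in> U n \<and> U n \<subseteq> X"
proof -
  obtain B :: "'b set set" where B: "countable B" "topological_basis B"
    using ex_countable_basis by blast
  have "B \<noteq> {}"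
    using topological_basisE[OF B(2) open_UNIV] by (metis UNIV_I empty_iff)
  show ?thesis
  proof (rule that[of "from_nat_into B"])
    show "open (from_nat_into B n)" for n
      using B(2) \<open>B \<noteq> {}\<close> by (simp add: from_nat_into topological_basis_open)
    show "\<exists>n. x \<in> from_nat_into B n \<and> from_nat_into B n \<subseteq> X" if X: "open X" "x \<in> X" for X x
    proof -
      obtain C where "C \<in> B" "x \<in> C" "C \<subseteq> X"
        using topological_basisE[OF B(2) X] by metis
      then show ?thesis
        using from_nat_into_surj[OF B(1)] by metis
    qed
  qed
qed

lemma finite_family_disjoint_nbhds:
  fixes v :: "'i \<Rightarrow> 'b::t2_space"
  assumes "finite I" "inj_on v I"
  obtains O' where "\<And>i. open (O' i)" "\<And>i. i \<in> I \<Longrightarrow> v i \<in> O' i"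
    "\<And>i j. i \<in> I \<Longrightarrow> j \<in> I \<Longrightarrow> i \<noteq> j \<Longrightarrow> O' i \<inter> O' j = {}"
proof -
  have "\<exists>A B. open A \<and> open B \<and> v i \<in> A \<and> v j \<in> B \<and> A \<inter> B = {}" if "i \<in> I" "j \<in> I" "i \<noteq> j" for i j
    using hausdorff[of "v i" "v j"] assms(2) that by (metis inj_onD)
  then obtain A B where AB: "\<And>i j. i \<in> I \<Longrightarrow> j \<in> I \<Longrightarrow> i \<noteq> j \<Longrightarrow>
      open (A i j) \<and> open (B i j) \<and> v i \<in> A i j \<and> v j \<in> B i j \<and> A i j \<inter> B i j = {}"
    by metis
  define O' where "O' = (\<lambda>i. if i \<in> I then \<Inter>j\<in>I - {i}. A i j \<inter> B j i else {})"
  show ?thesis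
  proof (rule that[of O'])
    show "open (O' i)" for i
      unfolding O'_def using assms(1) AB by (auto intro!: open_INT open_Int)
    show "v i \<in> O' i" if "i \<in> I" for i
      unfolding O'_def using AB that by auto
    show "O' i \<inter> O' j = {}" if ij: "i \<in> I" "j \<in> I" "i \<noteq> j" for i j
    proof -
      have "O' i \<subseteq> A i j" "O' j \<subseteq> B i j" unfolding O'_def using ij by auto
      then show ?thesis using AB[OF ij] by blast
    qed
  qed
qed

lemma Domain_single_valued_borel:
  fixes R :: "('a::polish_space \<times> 'b::polish_space) set"
  assumes "R \<in> sets borel" "single_valued R"
  shows "Domain R \<in> sets borel"
proof -
  have "fst ` R \<in> sets borel"
    using assms by (intro borel_inj_image borel_measurable_continuous_onI continuous_on_fst)
      (auto simp: inj_on_def single_valued_def)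
  then show ?thesis by (simp add: Domain_fst)
qed

text \<open>Where the section has the maximal size \<open>m + 1\<close>, it is cut into singletons by \<open>m + 1\<close> disjoint basic open
sets. For a fixed choice of these sets the points enumerating the section are unique, so Lusin--Souslin
applies to the projection; the remaining sections have at most \<open>m\<close> points.\<close>

lemma borel_single_valued_decomposition:
  fixes R :: "('a::polish_space \<times> 'b::polish_space) set"
  assumes "R \<in> sets borel" "\<And>x. finite (R `` {x}) \<and> card (R `` {x}) \<le> m"
  shows "\<exists>\<J>. finite \<J> \<and> (\<forall>J\<in>\<J>. J \<in> sets borel \<and> single_valued J) \<and> \<Union>\<J> = R"
  using assms
proof (induction m arbitrary: R)
  case 0
  then have "R `` {x} = {}" for x by (metis card_0_eq le_zero_eq)
  then have "R = {}" by (metis Image_singleton_iff empty_iff subrelI subset_empty)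
  then show ?case by (intro exI[of _ "{}"]) auto
next
  case (Suc m)
  obtain U :: "nat \<Rightarrow> 'b set" where U: "\<And>n. open (U n)"
    "\<And>X x. open X \<Longrightarrow> x \<in> X \<Longrightarrow> \<exists>n. x \<in> U n \<and> U n \<subseteq> X"
    using borel_basis_sequence by metis
  \<comment> \<open>\<open>t\<close> codes a list of indices of basic open sets, one for each of the
    \<open>m + 1\<close> cells, so there are only countably many choices of cells.\<close>
  define W where "W = (\<lambda>t i. U ((from_nat t :: nat list) ! i))"
  define good where "good = (\<lambda>t. \<forall>i\<le>m. \<forall>j\<le>m. i \<noteq> j \<longrightarrow> W t i \<inter> W t j = {})"
  define K where "K = (\<lambda>t. {x. good t \<and> (\<forall>i\<le>m. R `` {x} \<inter> W t i \<noteq> {})})"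
  have W_borel[measurable]: "W t i \<in> sets borel" for t i
    unfolding W_def using U(1) by simp
  \<comment> \<open>The section has at most \<open>m + 1\<close> points and each of the
    \<open>m + 1\<close> disjoint cells holds one, so every cell holds exactly one and no point is
    left over.\<close>
  have key: "R `` {x} = v ` {..m} \<and> (\<forall>i\<le>m. \<forall>y\<in>R `` {x} \<inter> W t i. y = v i)"
    if x: "x \<in> K t" and v: "\<And>i. i \<le> m \<Longrightarrow> v i \<in> R `` {x} \<inter> W t i" for x t v
  proof -
    have g: "good t" using x by (simp add: K_def)
    have inj: "inj_on v {..m}"
      using v g unfolding good_def inj_on_def by (metis IntD2 atMost_iff disjoint_iff)
    have "v ` {..m} \<subseteq> R `` {x}" using v by auto
    moreover have "card (R `` {x}) \<le> card (v ` {..m})"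
      using Suc.prems(2)[of x] inj by (simp add: card_image)
    ultimately have vR: "v ` {..m} = R `` {x}" using Suc.prems(2)[of x] by (metis card_seteq)
    moreover have "y = v i" if "i \<le> m" "y \<in> R `` {x}" "y \<in> W t i" for i y
    proof -
      have "y \<in> v ` {..m}" using that(2) vR by simp
      then obtain j where j: "j \<le> m" "y = v j" by auto
      then show ?thesis using v[of j] that(1,3) g unfolding good_def by (metis IntD2 disjoint_iff)
    qed
    ultimately show ?thesis by blast
  qed
  have key1: "R `` {x} = v ` {..m}" if "x \<in> K t" "\<forall>i\<le>m. v i \<in> R `` {x} \<inter> W t i" for x t v
    by (rule key[THEN conjunct1, OF that(1)]) (simp only: that(2))
  have key2: "y = v i"
    if "x \<in> K t" "\<forall>i\<le>m. v i \<in> R `` {x} \<inter> W t i" "i \<le> m" "(x, y) \<in> R" "y \<in> W t i" for x t v i y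
  proof -
    have "\<forall>i\<le>m. \<forall>y\<in>R `` {x} \<inter> W t i. y = v i"
      by (rule key[THEN conjunct2, OF that(1)]) (simp only: that(2))
    then show ?thesis using that(3-5) by simp
  qed
  have ex_v: "\<exists>v. \<forall>i\<le>m. v i \<in> R `` {x} \<inter> W t i" if "x \<in> K t" for x t
    using that unfolding K_def by (simp add: ex_in_conv[symmetric]) metis
  have K_borel: "K t \<in> sets borel" for t
  proof (cases "good t")
    case True
    \<comment> \<open>Sequences stand in for tuples of length \<open>m + 1\<close>: the entries
      beyond \<open>m\<close> are pinned to entry \<open>m\<close>, so that \<open>fst\<close>
      determines the whole sequence.\<close>
    define T where "T = {z::'a \<times> (nat \<Rightarrow> 'b). (\<forall>i\<le>m. (fst z, snd z i) \<in> R \<and> snd z i \<in> W t i)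
        \<and> (\<forall>i>m. snd z i = snd z m)}"
    have c: "continuous_on UNIV (\<lambda>z::'a \<times> (nat \<Rightarrow> 'b). snd z i)" for i
      by (rule continuous_on_compose2[OF continuous_on_product_coordinates continuous_on_snd[OF continuous_on_id]]) simp
    have [measurable]: "(\<lambda>z::'a \<times> (nat \<Rightarrow> 'b). snd z i) \<in> borel_measurable borel" for i
      using c by (rule borel_measurable_continuous_onI)
    have [measurable]: "(\<lambda>z::'a \<times> (nat \<Rightarrow> 'b). (fst z, snd z i)) \<in> borel_measurable borel" for i
      using c by (intro borel_measurable_continuous_onI continuous_intros)
    have [measurable]: "R \<in> sets borel" by (rule Suc.prems(1))
    have "{z \<in> space borel. (\<forall>i\<le>m. (fst z, snd z i) \<in> R \<and> snd z i \<in> W t i)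
        \<and> (\<forall>i>m. snd z i = snd z m)} \<in> sets (borel :: ('a \<times> (nat \<Rightarrow> 'b)) measure)"
      by measurable
    then have T_borel: "T \<in> sets borel" by (simp add: T_def)
    have sub: "fst z \<in> K t" if "z \<in> T" for z
      using that True unfolding T_def K_def by blast
    have "inj_on fst T"
    proof (rule inj_onI)
      fix z z' assume z: "z \<in> T" "z' \<in> T" "fst z = fst z'"
      have T: "snd y i \<in> R `` {fst z} \<inter> W t i" if "i \<le> m" "y = z \<or> y = z'" for i y
        using z that unfolding T_def by auto
      have "snd z' i = snd z i" if "i \<le> m" for i
        using key[OF sub[OF z(1)] T[OF _ disjI1[OF refl]], THEN conjunct2] T[OF that disjI2[OF refl]] that
        by simp
      moreover have "snd z i = snd z m" if "i > m" for i
        using z(1) that by (simp add: T_def)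
      moreover have "snd z' i = snd z' m" if "i > m" for i
        using z(2) that by (simp add: T_def)
      ultimately have "snd z i = snd z' i" for i by (metis le_eq_less_or_eq linorder_le_less_linear)
      then show "z = z'" using z(3) by (auto simp: prod_eq_iff)
    qed
    moreover have "fst ` T = K t"
    proof (intro equalityI subsetI)
      fix x assume "x \<in> K t"
      then obtain v where v: "\<forall>i\<le>m. v i \<in> R `` {x} \<inter> W t i" using ex_v by blast
      then have "(x, \<lambda>i. if i \<le> m then v i else v m) \<in> T" by (auto simp: T_def)
      then show "x \<in> fst ` T" by force
    qed (use sub in auto)
    ultimately show ?thesis
      using borel_inj_image[OF borel_measurable_continuous_onI[OF continuous_on_fst[OF continuous_on_id]] T_borel]
      by simp
  qed (simp add: K_def)
  define D where "D = (\<Union>t. K t)"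
  have D_borel: "D \<in> sets borel" unfolding D_def using K_borel by auto
  \<comment> \<open>Different choices of cells may number the same section differently; keeping the
    first choice for each \<open>x\<close> makes the \<open>i\<close>-th point a function of
    \<open>x\<close>.\<close>
  define K' where "K' = disjointed K"
  have K'_borel: "K' t \<in> sets borel" for t
    unfolding K'_def disjointed_def using K_borel by auto
  have K'_sub: "K' t \<subseteq> K t" for t unfolding K'_def by (rule disjointed_subset)
  have K'_D: "(\<Union>t. K' t) = D" unfolding K'_def D_def by (rule UN_disjointed_eq)
  have K'_disj: "t = u" if "x \<in> K' t" "x \<in> K' u" for x t u
    using disjoint_family_disjointed[of K] that unfolding disjoint_family_on_def K'_def by blast
  define J where "J = (\<lambda>i. \<Union>t. R \<inter> K' t \<times> W t i)"
  have J_borel: "J i \<in> sets borel" for i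
    unfolding J_def using Suc.prems(1) K'_borel W_borel by (intro sets.countable_UN image_subsetI sets.Int borel_Times)
  have J_sv: "single_valued (J i)" if "i \<le> m" for i
  proof (rule single_valuedI)
    fix x y z assume "(x, y) \<in> J i" "(x, z) \<in> J i"
    then obtain t u where t: "(x, y) \<in> R" "x \<in> K' t" "y \<in> W t i" and u: "(x, z) \<in> R" "x \<in> K' u" "z \<in> W u i"
      unfolding J_def by blast
    then have "u = t" using K'_disj by metis
    have "x \<in> K t" using t K'_sub by blast
    then obtain v where "\<forall>i\<le>m. v i \<in> R `` {x} \<inter> W t i" using ex_v by blast
    then show "y = z"
      using key2[OF \<open>x \<in> K t\<close> _ that] t(1,3) u(1,3) unfolding \<open>u = t\<close> by metis
  qed
  have J_UN: "(\<Union>i\<le>m. J i) = R \<inter> D \<times> UNIV"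
  proof (intro equalityI subsetI)
    fix p assume "p \<in> (\<Union>i\<le>m. J i)"
    then show "p \<in> R \<inter> D \<times> UNIV" unfolding J_def using K'_D by blast
  next
    fix p assume "p \<in> R \<inter> D \<times> UNIV"
    then obtain x y where p: "p = (x, y)" "(x, y) \<in> R" "x \<in> D" by blast
    then obtain t where t: "x \<in> K' t" using K'_D by blast
    then have "x \<in> K t" using K'_sub by blast
    then obtain v where v: "\<forall>i\<le>m. v i \<in> R `` {x} \<inter> W t i" using ex_v by blast
    then have "y \<in> v ` {..m}" using key1[OF \<open>x \<in> K t\<close>] p(2) by auto
    then obtain i where "i \<le> m" "y = v i" by auto
    then have "(x, y) \<in> R \<inter> K' t \<times> W t i" using v t p by simp
    then show "p \<in> (\<Union>i\<le>m. J i)" using \<open>i \<le> m\<close> p(1) unfolding J_def by auto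
  qed
  define R' where "R' = R - D \<times> UNIV"
  have R'_card: "finite (R' `` {x}) \<and> card (R' `` {x}) \<le> m" for x
  proof (cases "x \<in> D")
    case True
    then have "R' `` {x} = {}" unfolding R'_def by blast
    then show ?thesis by simp
  next
    case False
    then have eq: "R' `` {x} = R `` {x}" unfolding R'_def by blast
    \<comment> \<open>Otherwise \<open>m + 1\<close> points would have disjoint basic
      neighbourhoods, whose code \<open>t\<close> puts \<open>x\<close> into \<open>K t\<close> and
      so into \<open>D\<close>.\<close>
    have "card (R `` {x}) \<noteq> Suc m"
    proof
      assume c: "card (R `` {x}) = Suc m"
      have "card {..m} = card (R `` {x})" using c by simp
      then obtain v where v: "bij_betw v {..m} (R `` {x})"
        using Suc.prems(2)[of x] finite_same_card_bij[of "{..m}" "R `` {x}"] by blast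
      obtain O' where O': "\<And>i. open (O' i)" "\<And>i. i \<in> {..m} \<Longrightarrow> v i \<in> O' i"
        "\<And>i j. i \<in> {..m} \<Longrightarrow> j \<in> {..m} \<Longrightarrow> i \<noteq> j \<Longrightarrow> O' i \<inter> O' j = {}"
        using finite_family_disjoint_nbhds[of "{..m}" v] v[THEN bij_betw_imp_inj_on] by (metis finite_atMost)
      have "\<forall>i\<in>{..m}. \<exists>n. v i \<in> U n \<and> U n \<subseteq> O' i" using O'(1,2) U(2) by simp
      then obtain c where c: "\<And>i. i \<in> {..m} \<Longrightarrow> v i \<in> U (c i) \<and> U (c i) \<subseteq> O' i" by metis
      define t where "t = to_nat (map c [0..<Suc m])"
      have W: "W t i = U (c i)" if "i \<le> m" for i
        using that unfolding W_def t_def by (simp del: upt_Suc)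
      have "good t"
        unfolding good_def
      proof (intro allI impI)
        fix i j assume "i \<le> m" "j \<le> m" "i \<noteq> j"
        then show "W t i \<inter> W t j = {}" using O'(3)[of i j] c[of i] c[of j] W[of i] W[of j] by auto
      qed
      moreover have "v i \<in> R `` {x} \<inter> W t i" if "i \<le> m" for i
        using that v c W by (auto simp: bij_betw_def)
      ultimately have "x \<in> K t" unfolding K_def by blast
      then show False using False unfolding D_def by blast
    qed
    then show ?thesis using Suc.prems(2)[of x] eq by auto
  qed
  have "R' \<in> sets borel"
    unfolding R'_def using Suc.prems(1) D_borel by (intro sets.Diff borel_Times) auto
  then obtain \<J> where \<J>: "finite \<J>" "\<forall>J\<in>\<J>. J \<in> sets borel \<and> single_valued J" "\<Union>\<J> = R'"
    using Suc.IH[of R'] R'_card by metis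
  have "\<Union>(J ` {..m} \<union> \<J>) = R" using J_UN \<J>(3) unfolding R'_def by auto
  then show ?case using \<J> J_borel J_sv by (intro exI[of _ "J ` {..m} \<union> \<J>"]) auto
qed

section \<open>Borel partial injections\<close>

lemma borel_converse:
  fixes R :: "('a::polish_space \<times> 'a) set"
  assumes "R \<in> sets borel"
  shows "R\<inverse> \<in> sets borel"
proof -
  have "prod.swap \<in> borel_measurable (borel :: ('a \<times> 'a) measure)"
    by (intro borel_measurable_continuous_onI) (simp add: continuous_on_swap)
  from measurable_sets[OF this assms] show ?thesis
    by (simp add: converse_def vimage_def case_prod_beta' prod.swap_def)
qed

text \<open>The middle point of a composable pair is determined by the first point, so forgetting it
  is injective on the Borel set of triples \<open>T\<close>.\<close>

lemma borel_relcomp_single_valued: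
  fixes R S :: "('a::polish_space \<times> 'a) set"
  assumes R: "R \<in> sets borel" "single_valued R" and S: "S \<in> sets borel"
  shows "R O S \<in> sets borel"
proof -
  have [measurable]: "R \<in> sets borel" "S \<in> sets borel" by fact+
  have c: "continuous_on UNIV (\<lambda>z::'a \<times> 'a \<times> 'a. (fst z, fst (snd z)))"
    "continuous_on UNIV (\<lambda>z::'a \<times> 'a \<times> 'a. (fst z, snd (snd z)))"
    by (intro continuous_intros)+
  have [measurable]: "(\<lambda>z::'a \<times> 'a \<times> 'a. (fst z, fst (snd z))) \<in> borel_measurable borel"
    using c by (rule_tac borel_measurable_continuous_onI) simp
  have [measurable]: "(snd :: 'a \<times> 'a \<times> 'a \<Rightarrow> 'a \<times> 'a) \<in> borel_measurable borel"
    by (intro borel_measurable_continuous_onI continuous_intros)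
  define T where "T = {z::'a \<times> 'a \<times> 'a. (fst z, fst (snd z)) \<in> R \<and> snd z \<in> S}"
  have "{z::'a \<times> 'a \<times> 'a \<in> space borel. (fst z, fst (snd z)) \<in> R \<and> snd z \<in> S} \<in> sets borel"
    by measurable
  then have "T \<in> sets borel" by (simp add: T_def)
  moreover have "inj_on (\<lambda>z. (fst z, snd (snd z))) T"
    using assms(2) by (auto simp: inj_on_def T_def single_valued_def)
  ultimately have "(\<lambda>z. (fst z, snd (snd z))) ` T \<in> sets borel"
    using c(2) by (intro borel_inj_image borel_measurable_continuous_onI)
  also have "(\<lambda>z. (fst z, snd (snd z))) ` T = R O S"
    by (force simp: T_def image_iff)
  finally show ?thesis .
qed

text \<open>Partial maps are kept as graphs: converse, composition and restriction become relational
  operations, and Borelness is that of one set in the square.\<close>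

definition borel_pinj :: "('a::polish_space \<times> 'a) set \<Rightarrow> bool" where
  "borel_pinj R \<longleftrightarrow> R \<in> sets borel \<and> single_valued R \<and> single_valued (R\<inverse>)"

lemma borel_pinjD:
  assumes "borel_pinj R"
  shows "R \<in> sets borel" "(x, y) \<in> R \<Longrightarrow> (x, y') \<in> R \<Longrightarrow> y = y'" "(x, y) \<in> R \<Longrightarrow> (x', y) \<in> R \<Longrightarrow> x = x'"
  using assms unfolding borel_pinj_def single_valued_def by blast+

lemma borel_pinjI:
  assumes "R \<in> sets borel" "\<And>x y y'. (x, y) \<in> R \<Longrightarrow> (x, y') \<in> R \<Longrightarrow> y = y'"
    "\<And>x x' y. (x, y) \<in> R \<Longrightarrow> (x', y) \<in> R \<Longrightarrow> x = x'"
  shows "borel_pinj R"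
  using assms unfolding borel_pinj_def single_valued_def by blast

lemma borel_pinj_relcomp:
  assumes "borel_pinj R" "borel_pinj S"
  shows "borel_pinj (R O S)"
proof (rule borel_pinjI)
  show "R O S \<in> sets borel"
    using assms borel_relcomp_single_valued unfolding borel_pinj_def by blast
qed (use borel_pinjD(2,3)[OF assms(1)] borel_pinjD(2,3)[OF assms(2)] in \<open>metis relcompE Pair_inject\<close>)+

lemma borel_pinj_converse: "borel_pinj R \<Longrightarrow> borel_pinj (R\<inverse>)"
  by (simp add: borel_pinj_def borel_converse)

lemma borel_pinj_Int: "borel_pinj R \<Longrightarrow> S \<in> sets borel \<Longrightarrow> borel_pinj (R \<inter> S)"
  by (auto simp: borel_pinj_def single_valued_def)

lemma borel_Id_on:
  fixes A :: "'a::polish_space set"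
  assumes "A \<in> sets borel"
  shows "Id_on A \<in> sets borel"
proof -
  have "(\<lambda>x::'a. (x, x)) ` A \<in> sets borel"
    using assms by (intro borel_inj_image borel_measurable_continuous_onI continuous_intros) (auto simp: inj_on_def)
  also have "(\<lambda>x::'a. (x, x)) ` A = Id_on A" by auto
  finally show ?thesis .
qed

lemma borel_pinj_Id_on: "A \<in> sets borel \<Longrightarrow> borel_pinj (Id_on A)"
  by (intro borel_pinjI borel_Id_on) auto

text \<open>The way back from relations to maps. The preimage of \<open>B\<close> is the domain of a
  single-valued Borel relation, which gives measurability.\<close>

lemma borel_equidec_of_pinj:
  assumes \<theta>: "borel_pinj \<theta>" and sub: "\<theta> \<subseteq> E\<^sup>*"
  shows "borel_equidec E (Domain \<theta>) (Range \<theta>)"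
proof -
  define \<phi> where "\<phi> = (\<lambda>x. SOME y. (x, y) \<in> \<theta>)"
  have \<phi>: "(x, \<phi> x) \<in> \<theta>" if "x \<in> Domain \<theta>" for x
    using that unfolding \<phi>_def by (metis Domain.cases someI)
  have \<phi>_eq: "y = \<phi> x" if "(x, y) \<in> \<theta>" for x y
    using borel_pinjD(2)[OF \<theta>] \<phi> that by (metis DomainI)
  have "bij_betw \<phi> (Domain \<theta>) (Range \<theta>)"
    unfolding bij_betw_def
  proof
    show "inj_on \<phi> (Domain \<theta>)"
      using borel_pinjD(3)[OF \<theta>] \<phi> by (metis inj_onI)
    show "\<phi> ` Domain \<theta> = Range \<theta>"
      using \<phi> \<phi>_eq by (auto simp: image_iff)
  qed
  moreover have "\<phi> \<in> measurable (restrict_space borel (Domain \<theta>)) (restrict_space borel (Range \<theta>))"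
  proof (rule measurable_restrict_space2)
    show "\<phi> \<in> space (restrict_space borel (Domain \<theta>)) \<rightarrow> Range \<theta>"
      using \<phi> by (auto simp: space_restrict_space)
    show "\<phi> \<in> borel_measurable (restrict_space borel (Domain \<theta>))"
    proof (rule measurableI)
      fix B :: "'a set" assume B: "B \<in> sets borel"
      have "borel_pinj (\<theta> \<inter> UNIV \<times> B)" using B \<theta> by (intro borel_pinj_Int borel_Times) auto
      then have "Domain (\<theta> \<inter> UNIV \<times> B) \<in> sets borel"
        by (auto simp: borel_pinj_def intro: Domain_single_valued_borel)
      moreover have "\<phi> -` B \<inter> Domain \<theta> = Domain (\<theta> \<inter> UNIV \<times> B)"
        using \<phi> \<phi>_eq by auto
      ultimately show "\<phi> -` B \<inter> space (restrict_space borel (Domain \<theta>)) \<in> sets (restrict_space borel (Domain \<theta>))"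
        by (auto simp: space_restrict_space sets_restrict_space image_iff)
    qed simp
  qed
  ultimately show ?thesis
    unfolding borel_equidec_def same_comp_def using \<phi> sub by blast
qed

section \<open>Ranks in infinite sets of indices\<close>

lemma ex_rank:
  fixes N :: "nat set"
  assumes "infinite N"
  shows "\<exists>n\<in>N. card {l. l < n \<and> l \<in> N} = m"
proof (induction m)
  case 0
  define n where "n = (LEAST n. n \<in> N)"
  have "n \<in> N" unfolding n_def using assms by (metis LeastI infinite_imp_nonempty ex_in_conv)
  moreover have "{l. l < n \<and> l \<in> N} = {}" unfolding n_def using not_less_Least by auto
  ultimately show ?case by (metis card.empty)
next
  case (Suc m)
  then obtain n where n: "n \<in> N" "card {l. l < n \<and> l \<in> N} = m" by blast
  define n' where "n' = (LEAST n'. n < n' \<and> n' \<in> N)"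
  have "\<exists>n'. n < n' \<and> n' \<in> N" using assms by (metis infinite_nat_iff_unbounded)
  then have n': "n < n'" "n' \<in> N" unfolding n'_def by (metis (mono_tags, lifting) LeastI)+
  have "l \<le> n" if "l < n'" "l \<in> N" for l
    using not_less_Least[of l "\<lambda>n'. n < n' \<and> n' \<in> N"] that unfolding n'_def by auto
  then have "{l. l < n' \<and> l \<in> N} = insert n {l. l < n \<and> l \<in> N}"
    using n n' by (auto simp: le_less)
  then have "card {l. l < n' \<and> l \<in> N} = Suc m"
    using n(2) by simp
  then show ?case using n'(2) by blast
qed

lemma rank_inj:
  fixes N :: "nat set"
  assumes "n \<in> N" "n' \<in> N" "card {l. l < n \<and> l \<in> N} = card {l. l < n' \<and> l \<in> N}"
  shows "n = n'"
proof -
  have "card {l. l < a \<and> l \<in> N} < card {l. l < b \<and> l \<in> N}" if "a < b" "a \<in> N" for a b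
    by (rule psubset_card_mono) (use that in auto)
  from this[of n n'] this[of n' n] assms show ?thesis by (cases n n' rule: linorder_cases) auto
qed

section \<open>Large sets\<close>

text \<open>A countable Borel equivalence relation, presented in the spirit of Feldman--Moore but by
  partial injections. Any Borel \<open>R \<subseteq> Q\<close> splits into the single-valued pieces
  \<open>R \<inter> G n\<close>, whence Borel domains, ranges and images.\<close>

locale borel_pinj_cover =
  fixes V :: "'a::polish_space set" and Q :: "('a \<times> 'a) set" and G :: "nat \<Rightarrow> ('a \<times> 'a) set"
  assumes V_borel: "V \<in> sets borel" and equiv: "equiv V Q"
    and Q_eq: "Q = (\<Union>n. G n)" and G: "\<And>n. borel_pinj (G n)"
begin

lemma Q_refl: "x \<in> V \<Longrightarrow> (x, x) \<in> Q"
  using equiv by (simp add: equiv_def refl_on_def)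

lemma Q_sym: "(x, y) \<in> Q \<Longrightarrow> (y, x) \<in> Q"
  using equiv by (simp add: equiv_def sym_def)

lemma Q_trans: "(x, y) \<in> Q \<Longrightarrow> (y, z) \<in> Q \<Longrightarrow> (x, z) \<in> Q"
  using equiv unfolding equiv_def by (meson transD)

lemma Q_V: "(x, y) \<in> Q \<Longrightarrow> x \<in> V \<and> y \<in> V"
  using equiv_type[OF equiv] by auto

lemma Q_borel: "Q \<in> sets borel"
  unfolding Q_eq using borel_pinjD(1)[OF G] by (intro sets.countable_UN image_subsetI)

lemma Domain_borel:
  assumes "R \<in> sets borel" "R \<subseteq> Q"
  shows "Domain R \<in> sets borel"
proof -
  have "R \<inter> G n \<in> sets borel \<and> single_valued (R \<inter> G n)" for n
    using borel_pinj_Int[OF G assms(1), of n] by (simp add: borel_pinj_def Int_commute)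
  then have "Domain (R \<inter> G n) \<in> sets borel" for n
    by (simp add: Domain_single_valued_borel)
  moreover have "Domain R = (\<Union>n. Domain (R \<inter> G n))"
    using assms(2) unfolding Q_eq by blast
  ultimately show ?thesis by (metis (no_types) sets.countable_UN image_subsetI)
qed

lemma Range_borel:
  assumes "R \<in> sets borel" "R \<subseteq> Q"
  shows "Range R \<in> sets borel"
proof -
  have "R\<inverse> \<subseteq> Q" using assms(2) Q_sym by auto
  then show ?thesis using Domain_borel[OF borel_converse[OF assms(1)]] by simp
qed

lemma Image_borel:
  assumes "R \<in> sets borel" "R \<subseteq> Q" "B \<in> sets borel"
  shows "R `` B \<in> sets borel"
proof -
  have "Range (R \<inter> B \<times> UNIV) \<in> sets borel"
    using assms by (intro Range_borel sets.Int borel_Times) auto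
  moreover have "Range (R \<inter> B \<times> UNIV) = R `` B" by auto
  ultimately show ?thesis by simp
qed

text \<open>The common domain is only a complete section: the pigeonhole argument drops points of
  \<open>S\<close>, and what remains still meets every component.\<close>

definition large :: "'a set \<Rightarrow> bool" where
  "large U \<longleftrightarrow> U \<in> sets borel \<and> U \<subseteq> V \<and> (\<exists>S H. S \<in> sets borel \<and> Q `` S = V
     \<and> (\<forall>n::nat. borel_pinj (H n) \<and> H n \<subseteq> Q \<and> Domain (H n) = S \<and> Range (H n) \<subseteq> U)
     \<and> (\<forall>m n z. z \<in> Range (H m) \<longrightarrow> z \<in> Range (H n) \<longrightarrow> m = n))"

lemma largeE:
  assumes "large U"
  obtains S H where "S \<in> sets borel" "Q `` S = V" "\<And>n::nat. borel_pinj (H n)" "\<And>n. H n \<subseteq> Q"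
    "\<And>n. Domain (H n) = S" "\<And>n. Range (H n) \<subseteq> U"
    "\<And>m n z. z \<in> Range (H m) \<Longrightarrow> z \<in> Range (H n) \<Longrightarrow> m = n"
  using assms unfolding large_def by metis

lemma large_sub: "large U \<Longrightarrow> U \<subseteq> V"
  by (simp add: large_def)

lemma large_borel: "large U \<Longrightarrow> U \<in> sets borel"
  by (simp add: large_def)

lemma large_mono:
  assumes "large U" "U \<subseteq> U'" "U' \<subseteq> V" "U' \<in> sets borel"
  shows "large U'"
proof -
  obtain S H where *: "S \<in> sets borel" "Q `` S = V" "\<And>n::nat. borel_pinj (H n)" "\<And>n. H n \<subseteq> Q"
    "\<And>n. Domain (H n) = S" "\<And>n. Range (H n) \<subseteq> U"
    "\<And>m n z. z \<in> Range (H m) \<Longrightarrow> z \<in> Range (H n) \<Longrightarrow> m = n"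
    using largeE[OF assms(1)] by metis
  have "Range (H n) \<subseteq> U'" for n using *(6)[of n] assms(2) by simp
  then show ?thesis unfolding large_def using * assms(3,4) by metis
qed

text \<open>The \<open>m\<close>-th new injection maps \<open>a\<close> by the \<open>m\<close>-th of the given ones that is defined at \<open>a\<close>.\<close>

lemma largeI_infinite:
  assumes U: "U \<in> sets borel" "U \<subseteq> V" and S: "S \<in> sets borel" "Q `` S = V"
    and H: "\<And>n::nat. borel_pinj (H n)" "\<And>n. H n \<subseteq> Q" "\<And>n. Range (H n) \<subseteq> U"
    and disj: "\<And>m n z. z \<in> Range (H m) \<Longrightarrow> z \<in> Range (H n) \<Longrightarrow> m = n"
    and inf: "\<And>a. a \<in> S \<Longrightarrow> infinite {n. a \<in> Domain (H n)}"
  shows "large U"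
proof -
  define N where "N = (\<lambda>a. {n. a \<in> Domain (H n)})"
  define P where "P = (\<lambda>n m. {a. card {l. l < n \<and> l \<in> N a} = m})"
  have [measurable]: "Domain (H n) \<in> sets borel" for n
    using H(1,2) borel_pinjD(1) by (blast intro: Domain_borel)
  have "(\<lambda>a::'a. card {l. l < n \<and> l \<in> N a}) \<in> measurable borel (count_space UNIV)" for n
  proof (rule measurable_card)
    fix i
    show "{a \<in> space borel. i \<in> {l. l < n \<and> l \<in> N a}} \<in> sets borel"
      unfolding N_def by (cases "i < n") auto
  qed
  then have meas: "(\<lambda>a::'a. card {l. l < n \<and> l \<in> N a}) -` {m} \<inter> space borel \<in> sets borel" for n m
    by (rule measurable_sets) simp
  have "P n m = (\<lambda>a::'a. card {l. l < n \<and> l \<in> N a}) -` {m} \<inter> space borel" for n m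
    unfolding P_def by auto
  then have P_borel: "P n m \<in> sets borel" for n m
    using meas[of n m] by (simp only:)
  define H' where "H' = (\<lambda>m. \<Union>n. H n \<inter> (P n m \<inter> S) \<times> UNIV)"
  have H'D: "\<exists>n. (a, z) \<in> H n \<and> a \<in> S \<and> n \<in> N a \<and> card {l. l < n \<and> l \<in> N a} = m"
    if "(a, z) \<in> H' m" for a z m
    using that unfolding H'_def P_def N_def by blast
  have pinj: "borel_pinj (H' m)" for m
  proof (rule borel_pinjI)
    have "H n \<inter> (P n m \<inter> S) \<times> UNIV \<in> sets borel" for n
      using borel_pinjD(1)[OF H(1)] P_borel S(1) by (intro sets.Int borel_Times) auto
    then show "H' m \<in> sets borel" unfolding H'_def by (intro sets.countable_UN image_subsetI)
  next
    fix a z z' assume a: "(a, z) \<in> H' m" "(a, z') \<in> H' m"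
    obtain n where n: "(a, z) \<in> H n" "n \<in> N a" "card {l. l < n \<and> l \<in> N a} = m"
      using H'D[OF a(1)] by blast
    obtain n' where n': "(a, z') \<in> H n'" "n' \<in> N a" "card {l. l < n' \<and> l \<in> N a} = m"
      using H'D[OF a(2)] by blast
    have "n' = n" by (rule rank_inj[OF n'(2) n(2)]) (simp add: n(3) n'(3))
    then show "z = z'" using borel_pinjD(2)[OF H(1)[of n]] n(1) n'(1) by simp
  next
    fix a a' z assume a: "(a, z) \<in> H' m" "(a', z) \<in> H' m"
    obtain n where n: "(a, z) \<in> H n" using H'D[OF a(1)] by blast
    obtain n' where n': "(a', z) \<in> H n'" using H'D[OF a(2)] by blast
    have "n' = n" by (rule disj[OF RangeI[OF n'] RangeI[OF n]])
    then show "a = a'" using borel_pinjD(3)[OF H(1)[of n]] n n' by simp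
  qed
  have sub: "H' m \<subseteq> Q" for m unfolding H'_def using H(2) by (intro UN_least) (meson inf.coboundedI1)
  have dom: "Domain (H' m) = S" for m
  proof (intro equalityI subsetI)
    fix a assume a: "a \<in> S"
    then obtain n where n: "n \<in> N a" "card {l. l < n \<and> l \<in> N a} = m"
      using ex_rank[of "N a" m] inf[OF a] unfolding N_def by blast
    then obtain z where "(a, z) \<in> H n" unfolding N_def by blast
    then have "(a, z) \<in> H' m" using n a unfolding H'_def P_def by blast
    then show "a \<in> Domain (H' m)" by blast
  qed (use H'D in blast)
  have ran: "Range (H' m) \<subseteq> U" for m
  proof
    fix z assume "z \<in> Range (H' m)"
    then obtain n where "z \<in> Range (H n)" using H'D by (metis Range.simps)
    then show "z \<in> U" using H(3)[of n] by auto
  qed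
  have "m = m'" if z: "z \<in> Range (H' m)" "z \<in> Range (H' m')" for m m' z
  proof -
    obtain a where "(a, z) \<in> H' m" using z(1) by auto
    then obtain n where n: "(a, z) \<in> H n" "card {l. l < n \<and> l \<in> N a} = m" using H'D by blast
    obtain a' where "(a', z) \<in> H' m'" using z(2) by auto
    then obtain n' where n': "(a', z) \<in> H n'" "card {l. l < n' \<and> l \<in> N a'} = m'" using H'D by blast
    have "n' = n" using disj[of z n' n] n(1) n'(1) by auto
    moreover have "a' = a" using borel_pinjD(3)[OF H(1)[of n]] n(1) n'(1) \<open>n' = n\<close> by metis
    ultimately show ?thesis using n n' by simp
  qed
  then show ?thesis unfolding large_def using U S pinj sub dom ran by metis
qed

text \<open>Send \<open>x\<close> to the first \<open>G n\<close>-image of \<open>x\<close> in \<open>S\<close>, then apply \<open>H n\<close>: the value remembers both \<open>n\<close> and the image.\<close>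

lemma large_imp_injection:
  assumes "large U"
  obtains M where "borel_pinj M" "M \<subseteq> Q" "Domain M = V" "Range M \<subseteq> U"
proof -
  obtain S H where S: "S \<in> sets borel" "Q `` S = V" and H: "\<And>n::nat. borel_pinj (H n)" "\<And>n. H n \<subseteq> Q"
    "\<And>n. Domain (H n) = S" "\<And>n. Range (H n) \<subseteq> U"
    and disj: "\<And>m n z. z \<in> Range (H m) \<Longrightarrow> z \<in> Range (H n) \<Longrightarrow> m = n"
    using largeE[OF assms] by metis
  have GQ: "G n \<subseteq> Q" for n unfolding Q_eq by blast
  define D where "D = disjointed (\<lambda>n. Domain (G n \<inter> UNIV \<times> S))"
  have D0_borel: "Domain (G n \<inter> UNIV \<times> S) \<in> sets borel" for n
    using GQ[of n] borel_pinjD(1)[OF G] S(1) by (intro Domain_borel sets.Int borel_Times) auto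
  have D_borel: "D n \<in> sets borel" for n
    unfolding D_def disjointed_def using D0_borel by auto
  have D_sub: "D n \<subseteq> Domain (G n \<inter> UNIV \<times> S)" for n unfolding D_def by (rule disjointed_subset)
  have D_disj: "n = n'" if "x \<in> D n" "x \<in> D n'" for x n n'
    using disjoint_family_disjointed[of "\<lambda>n. Domain (G n \<inter> UNIV \<times> S)"] that
    unfolding disjoint_family_on_def D_def by blast
  have D_UN: "x \<in> V \<Longrightarrow> \<exists>n. x \<in> D n" for x
  proof -
    assume "x \<in> V"
    then obtain a where a: "a \<in> S" "(a, x) \<in> Q" using S(2) by blast
    then obtain n where "(x, a) \<in> G n" using Q_sym unfolding Q_eq by blast
    then have "x \<in> (\<Union>n. Domain (G n \<inter> UNIV \<times> S))" using a by blast
    also have "\<dots> = (\<Union>n. D n)" unfolding D_def by (rule UN_disjointed_eq[symmetric])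
    finally show "\<exists>n. x \<in> D n" by simp
  qed
  define M where "M = (\<Union>n. (G n \<inter> D n \<times> S) O H n)"
  have MD: "\<exists>n y. x \<in> D n \<and> (x, y) \<in> G n \<and> (y, z) \<in> H n" if "(x, z) \<in> M" for x z
    using that unfolding M_def by blast
  have GD: "borel_pinj (G n \<inter> D n \<times> S)" for n
    using D_borel[of n] S(1) by (intro borel_pinj_Int G borel_Times)
  have "borel_pinj M"
  proof (rule borel_pinjI)
    have "(G n \<inter> D n \<times> S) O H n \<in> sets borel" for n
      using borel_pinjD(1)[OF borel_pinj_relcomp[OF GD H(1)]] .
    then show "M \<in> sets borel" unfolding M_def by (intro sets.countable_UN image_subsetI)
  next
    fix x z z' assume x: "(x, z) \<in> M" "(x, z') \<in> M"
    obtain n y where y: "x \<in> D n" "(x, y) \<in> G n" "(y, z) \<in> H n" using MD[OF x(1)] by blast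
    obtain n' y' where y': "x \<in> D n'" "(x, y') \<in> G n'" "(y', z') \<in> H n'" using MD[OF x(2)] by blast
    have "n' = n" by (rule D_disj[OF y'(1) y(1)])
    moreover have "y' = y" using borel_pinjD(2)[OF G[of n]] y y' calculation by simp
    ultimately show "z = z'" using borel_pinjD(2)[OF H(1)[of n]] y y' by simp
  next
    fix x x' z assume x: "(x, z) \<in> M" "(x', z) \<in> M"
    obtain n y where y: "(x, y) \<in> G n" "(y, z) \<in> H n" using MD[OF x(1)] by blast
    obtain n' y' where y': "(x', y') \<in> G n'" "(y', z) \<in> H n'" using MD[OF x(2)] by blast
    have "n' = n" by (rule disj[OF RangeI[OF y'(2)] RangeI[OF y(2)]])
    moreover have "y' = y" using borel_pinjD(3)[OF H(1)[of n]] y y' calculation by simp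
    ultimately show "x = x'" using borel_pinjD(3)[OF G[of n]] y y' by simp
  qed
  moreover have MQ: "M \<subseteq> Q"
  proof (rule subrelI)
    fix x z assume "(x, z) \<in> M"
    then obtain n y where "(x, y) \<in> G n" "(y, z) \<in> H n" using MD by metis
    then show "(x, z) \<in> Q" using GQ[of n] H(2)[of n] Q_trans by blast
  qed
  moreover have "Domain M = V"
  proof (intro equalityI subsetI)
    fix x assume "x \<in> Domain M"
    then show "x \<in> V" using MQ Q_V by blast
  next
    fix x assume "x \<in> V"
    then obtain n where n: "x \<in> D n" using D_UN by blast
    then obtain y where y: "(x, y) \<in> G n" "y \<in> S" using D_sub[of n] by blast
    then obtain z where "(y, z) \<in> H n" using H(3)[of n] by blast
    then have "(x, z) \<in> M" using n y unfolding M_def by blast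
    then show "x \<in> Domain M" by blast
  qed
  moreover have "Range M \<subseteq> U"
  proof
    fix z assume "z \<in> Range M"
    then obtain n y where "(y, z) \<in> H n" using MD by (metis Range.simps)
    then show "z \<in> U" using H(4)[of n] by blast
  qed
  ultimately show ?thesis by (rule that)
qed

text \<open>Schroeder--Bernstein with the inclusion of \<open>U\<close> in \<open>V\<close> as
  second injection. \<open>Z\<close> is the forward orbit of \<open>V - U\<close> under
  \<open>M\<close>; moving \<open>Z\<close> by \<open>M\<close> vacates exactly
  \<open>V - U\<close>, while the rest of \<open>V\<close> lies in \<open>U\<close> and stays
  fixed.\<close>

lemma large_imp_bijection:
  assumes "large U"
  obtains \<theta> where "borel_pinj \<theta>" "\<theta> \<subseteq> Q" "Domain \<theta> = V" "Range \<theta> = U"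
proof -
  obtain M where M: "borel_pinj M" "M \<subseteq> Q" "Domain M = V" "Range M \<subseteq> U"
    using large_imp_injection[OF assms] by metis
  note UV = large_sub[OF assms]
  note MD = borel_pinjD[OF M(1)]
  define Z where "Z = (\<Union>n. ((\<lambda>Y. M `` Y) ^^ n) (V - U))"
  have Zn: "((\<lambda>Y. M `` Y) ^^ n) (V - U) \<in> sets borel" for n
    using M V_borel large_borel[OF assms] by (induction n) (auto intro!: Image_borel MD(1))
  then have Z_borel: "Z \<in> sets borel" unfolding Z_def by (intro sets.countable_UN image_subsetI)
  have Z_eq: "Z = (V - U) \<union> M `` Z"
  proof -
    have "Z = (\<Union>n\<in>{0} \<union> range Suc. ((\<lambda>Y. M `` Y) ^^ n) (V - U))"
      unfolding Z_def by (metis UNIV_nat_eq insert_is_Un)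
    also have "\<dots> = (V - U) \<union> (\<Union>n. M `` ((\<lambda>Y. M `` Y) ^^ n) (V - U))" by simp
    also have "(\<Union>n. M `` ((\<lambda>Y. M `` Y) ^^ n) (V - U)) = M `` Z" unfolding Z_def by blast
    finally show ?thesis .
  qed
  have MZ: "y \<in> Z" if "(x, y) \<in> M" "x \<in> Z" for x y
    using that Z_eq by blast
  define \<theta> where "\<theta> = (M \<inter> Z \<times> UNIV) \<union> Id_on (V - Z)"
  have "borel_pinj \<theta>"
  proof (rule borel_pinjI)
    show "\<theta> \<in> sets borel"
      unfolding \<theta>_def using MD(1) Z_borel V_borel
      by (intro sets.Un sets.Int borel_Times borel_Id_on sets.Diff) auto
    show "y = y'" if "(x, y) \<in> \<theta>" "(x, y') \<in> \<theta>" for x y y'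
      using that MD(2) unfolding \<theta>_def by auto
    show "x = x'" if "(x, y) \<in> \<theta>" "(x', y) \<in> \<theta>" for x x' y
      using that MD(3) MZ unfolding \<theta>_def by auto
  qed
  moreover have "\<theta> \<subseteq> Q" unfolding \<theta>_def using M(2) Q_refl by auto
  moreover have "Domain \<theta> = V"
  proof -
    have "Z \<subseteq> V" using Z_eq M(4) UV by auto
    moreover have "Domain \<theta> = Domain M \<inter> Z \<union> (V - Z)" unfolding \<theta>_def by auto
    ultimately show ?thesis using M(3) by auto
  qed
  moreover have "Range \<theta> = U"
  proof -
    have "Range \<theta> = M `` Z \<union> (V - Z)" unfolding \<theta>_def by auto
    then show ?thesis using Z_eq M(4) UV by auto
  qed
  ultimately show ?thesis by (rule that)
qed

text \<open>Each \<open>a \<in> S\<close> has some \<open>i < d\<close> such that infinitely many \<open>H n a\<close> lie in the domain of \<open>R i\<close>; \<open>W i\<close>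
consists of the components on which \<open>i\<close> is the least such index. Restricting to one \<open>i\<close> per component
keeps the ranges disjoint.\<close>

lemma large_pigeonhole:
  assumes U0: "large U0" and R: "\<And>i. i < d \<Longrightarrow> borel_pinj (R i) \<and> R i \<subseteq> Q"
    and cover: "U0 \<subseteq> (\<Union>i<d. Domain (R i))"
  obtains W :: "nat \<Rightarrow> 'a set" where "\<And>i. W i \<in> sets borel" "\<And>i x y. x \<in> W i \<Longrightarrow> (x, y) \<in> Q \<Longrightarrow> y \<in> W i"
    "\<And>i j x. x \<in> W i \<Longrightarrow> x \<in> W j \<Longrightarrow> i = j" "large (\<Union>i<d. R i `` W i)"
proof -
  obtain S H where S: "S \<in> sets borel" "Q `` S = V" and H: "\<And>n::nat. borel_pinj (H n)" "\<And>n. H n \<subseteq> Q"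
    "\<And>n. Domain (H n) = S" "\<And>n. Range (H n) \<subseteq> U0"
    and disj: "\<And>m n z. z \<in> Range (H m) \<Longrightarrow> z \<in> Range (H n) \<Longrightarrow> m = n"
    using largeE[OF U0] by metis
  have HR: "borel_pinj (H n O R i)" "H n O R i \<subseteq> Q" if "i < d" for i n
  proof -
    show "borel_pinj (H n O R i)" using R[OF that] H(1) by (simp add: borel_pinj_relcomp)
    show "H n O R i \<subseteq> Q" using R[OF that] H(2)[of n] Q_trans by blast
  qed
  \<comment> \<open>"Infinitely many \<open>n\<close>" is written as a limit superior to make it
    visibly Borel. The empty value for \<open>i \<ge> d\<close> lets \<open>disjointed\<close> run
    over all natural numbers.\<close>
  define T where "T = (\<lambda>i. if i < d then S \<inter> (\<Inter>m. \<Union>n\<in>{m..}. Domain (H n O R i)) else {})"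
  have T_iff: "a \<in> T i \<longleftrightarrow> i < d \<and> a \<in> S \<and> infinite {n. a \<in> Domain (H n O R i)}" for a i
    unfolding T_def infinite_nat_iff_unbounded_le by (simp add: Bex_def)
  have T_borel: "T i \<in> sets borel" for i
  proof (cases "i < d")
    case True
    have "Domain (H n O R i) \<in> sets borel" for n
      using HR[OF True, of n] borel_pinjD(1) by (blast intro: Domain_borel)
    then have "(\<Union>n\<in>{m..}. Domain (H n O R i)) \<in> sets borel" for m
      by (intro sets.countable_UN image_subsetI)
    then have "(\<Inter>m. \<Union>n\<in>{m..}. Domain (H n O R i)) \<in> sets borel"
      by (intro sets.countable_INT'') simp_all
    then show ?thesis using True S(1) by (simp add: T_def sets.Int)
  qed (simp add: T_def)
  define Z where "Z = (\<lambda>i. Q `` T i)"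
  have Z_borel: "Z i \<in> sets borel" for i
    unfolding Z_def using Q_borel T_borel by (intro Image_borel) auto
  have Z_inv: "y \<in> Z i" if "x \<in> Z i" "(x, y) \<in> Q" for x y i
    using that Q_trans unfolding Z_def by blast
  define W where "W = disjointed Z"
  have W_borel: "W i \<in> sets borel" for i
    unfolding W_def disjointed_def using Z_borel by auto
  have W_inv: "y \<in> W i" if "x \<in> W i" "(x, y) \<in> Q" for x y i
    using that Z_inv Q_sym unfolding W_def disjointed_def by auto
  have W_disj: "i = j" if "x \<in> W i" "x \<in> W j" for x i j
    using disjoint_family_disjointed[of Z] that unfolding disjoint_family_on_def W_def by blast
  have W_UN: "(\<Union>i. W i) = (\<Union>i. Z i)" unfolding W_def by (rule UN_disjointed_eq)
  have S_T: "\<exists>i. a \<in> T i" if "a \<in> S" for a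
  proof -
    have "\<exists>i<d. a \<in> Domain (H n O R i)" for n
    proof -
      from that obtain y where y: "(a, y) \<in> H n" using H(3)[of n] by blast
      then have "y \<in> U0" using H(4)[of n] by blast
      then obtain i where "i < d" "y \<in> Domain (R i)" using cover by blast
      then show ?thesis using y by blast
    qed
    then have "UNIV = (\<Union>i<d. {n. a \<in> Domain (H n O R i)})" by blast
    then have "infinite (\<Union>i<d. {n. a \<in> Domain (H n O R i)})" by (metis infinite_UNIV_nat)
    then show ?thesis using that unfolding T_iff by blast
  qed
  \<comment> \<open>A point of \<open>S\<close> in \<open>W i\<close> may itself fail to lie in
    \<open>T i\<close> and is dropped; its component still meets \<open>T i\<close>, since
    \<open>W i\<close> lies in the saturation of \<open>T i\<close>.\<close>
  define S' where "S' = (\<Union>i. T i \<inter> W i)"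
  have S'_borel: "S' \<in> sets borel" unfolding S'_def using T_borel W_borel by auto
  have S'_sat: "Q `` S' = V"
  proof (intro equalityI subsetI)
    fix x assume "x \<in> Q `` S'" then show "x \<in> V" using Q_V by blast
  next
    fix x assume "x \<in> V"
    then obtain a where "a \<in> S" "(a, x) \<in> Q" using S(2) by blast
    then have "x \<in> (\<Union>i. Z i)" using S_T[of a] unfolding Z_def by blast
    then obtain i where i: "x \<in> W i" using W_UN by blast
    then have "x \<in> Z i" using disjointed_subset[of Z i] unfolding W_def by blast
    then obtain b where b: "b \<in> T i" "(b, x) \<in> Q" unfolding Z_def by blast
    then have "b \<in> W i" using W_inv[OF i Q_sym] by simp
    then show "x \<in> Q `` S'" using b unfolding S'_def by blast
  qed
  \<comment> \<open>At a point of \<open>S'\<close> only infinitely many of the \<open>H' n\<close>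
    need be defined; \<open>largeI_infinite\<close> repairs this by renumbering them
    pointwise.\<close>
  define H' where "H' = (\<lambda>n. \<Union>i<d. (H n O R i) \<inter> W i \<times> UNIV)"
  have H'D: "\<exists>i y. i < d \<and> a \<in> W i \<and> z \<in> W i \<and> y \<in> W i \<and> (a, y) \<in> H n \<and> (y, z) \<in> R i"
    if "(a, z) \<in> H' n" for a z n
  proof -
    from that obtain i y where i: "i < d" "a \<in> W i" "(a, y) \<in> H n" "(y, z) \<in> R i"
      unfolding H'_def by blast
    then have "(a, y) \<in> Q" "(y, z) \<in> Q" using H(2)[of n] R[of i] by auto
    then show ?thesis using i W_inv by metis
  qed
  define U where "U = (\<Union>i<d. R i `` W i)"
  have "large U"
  proof (rule largeI_infinite[OF _ _ S'_borel S'_sat, of U H'])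
    show "U \<in> sets borel"
      unfolding U_def using R W_borel borel_pinjD(1) by (intro sets.finite_UN Image_borel) auto
    show "U \<subseteq> V" unfolding U_def using R Q_V by blast
    show "borel_pinj (H' n)" for n
    proof (rule borel_pinjI)
      show "H' n \<in> sets borel"
        unfolding H'_def using HR(1)[THEN borel_pinjD(1)] W_borel
        by (intro sets.finite_UN sets.Int borel_Times) auto
    next
      fix a z z' assume a: "(a, z) \<in> H' n" "(a, z') \<in> H' n"
      obtain i y where i: "i < d" "a \<in> W i" "(a, y) \<in> H n" "(y, z) \<in> R i" using H'D[OF a(1)] by blast
      obtain i' y' where i': "i' < d" "a \<in> W i'" "(a, y') \<in> H n" "(y', z') \<in> R i'" using H'D[OF a(2)] by blast
      have "i' = i" by (rule W_disj[OF i'(2) i(2)])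
      moreover have "y' = y" by (rule borel_pinjD(2)[OF H(1) i'(3) i(3)])
      ultimately show "z = z'" using borel_pinjD(2)[OF R[OF i(1), THEN conjunct1]] i(4) i'(4) by simp
    next
      fix a a' z assume a: "(a, z) \<in> H' n" "(a', z) \<in> H' n"
      obtain i y where i: "i < d" "z \<in> W i" "(a, y) \<in> H n" "(y, z) \<in> R i" using H'D[OF a(1)] by blast
      obtain i' y' where i': "i' < d" "z \<in> W i'" "(a', y') \<in> H n" "(y', z) \<in> R i'" using H'D[OF a(2)] by blast
      have "i' = i" by (rule W_disj[OF i'(2) i(2)])
      then have "y' = y" using borel_pinjD(3)[OF R[OF i(1), THEN conjunct1]] i(4) i'(4) by simp
      then show "a = a'" using borel_pinjD(3)[OF H(1)[of n]] i(3) i'(3) by simp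
    qed
    show "H' n \<subseteq> Q" for n using HR(2) unfolding H'_def by blast
    show "Range (H' n) \<subseteq> U" for n
    proof
      fix z assume "z \<in> Range (H' n)"
      then obtain i y where "i < d" "y \<in> W i" "(y, z) \<in> R i" using H'D by (metis Range.simps)
      then show "z \<in> U" unfolding U_def by blast
    qed
    show "n = n'" if z: "z \<in> Range (H' n)" "z \<in> Range (H' n')" for n n' z
    proof -
      obtain a where "(a, z) \<in> H' n" using z(1) by blast
      then obtain i y where i: "i < d" "z \<in> W i" "(a, y) \<in> H n" "(y, z) \<in> R i" using H'D by blast
      obtain a' where "(a', z) \<in> H' n'" using z(2) by blast
      then obtain i' y' where i': "i' < d" "z \<in> W i'" "(a', y') \<in> H n'" "(y', z) \<in> R i'" using H'D by blast
      have "i' = i" by (rule W_disj[OF i'(2) i(2)])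
      then have "y' = y" using borel_pinjD(3)[OF R[OF i(1), THEN conjunct1]] i(4) i'(4) by simp
      then show ?thesis using disj[of y n n'] i(3) i'(3) by auto
    qed
    show "infinite {n. a \<in> Domain (H' n)}" if "a \<in> S'" for a
    proof -
      from that obtain i where i: "a \<in> T i" "a \<in> W i" unfolding S'_def by blast
      have "{n. a \<in> Domain (H n O R i)} \<subseteq> {n. a \<in> Domain (H' n)}"
        using i(2) i(1)[unfolded T_iff] unfolding H'_def by blast
      then show ?thesis using i(1) infinite_super unfolding T_iff by blast
    qed
  qed
  then show ?thesis using that[of W] W_borel W_inv W_disj unfolding U_def by blast
qed

text \<open>Pairing splits one sequence of injections into infinitely many infinite ones, all with
  the same complete section as domain.\<close>

lemma large_split:
  assumes "large U"
  shows "\<exists>C :: nat \<Rightarrow> 'a set. (\<forall>j. large (C j) \<and> C j \<subseteq> U) \<and> disjoint_family C"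
proof -
  obtain S H where S: "S \<in> sets borel" "Q `` S = V" and H: "\<And>n::nat. borel_pinj (H n)" "\<And>n. H n \<subseteq> Q"
    "\<And>n. Domain (H n) = S" "\<And>n. Range (H n) \<subseteq> U"
    and disj: "\<And>m n z. z \<in> Range (H m) \<Longrightarrow> z \<in> Range (H n) \<Longrightarrow> m = n"
    using largeE[OF assms] by metis
  define C where "C = (\<lambda>j. \<Union>n. Range (H (prod_encode (j, n))))"
  have sub: "C j \<subseteq> U" for j unfolding C_def using H(4) by (intro UN_least)
  show ?thesis
  proof (intro exI[of _ C] conjI allI)
    show "C j \<subseteq> U" for j by (rule sub)
    have "i = j" if "x \<in> C i" "x \<in> C j" for i j x
    proof -
      from that obtain n m where "x \<in> Range (H (prod_encode (i, n)))" "x \<in> Range (H (prod_encode (j, m)))"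
        unfolding C_def by blast
      then have "prod_encode (i, n) = prod_encode (j, m)" by (rule disj)
      then show ?thesis by simp
    qed
    then show "disjoint_family C" unfolding disjoint_family_on_def by (metis disjoint_iff)
    show "large (C j)" for j
    proof -
      have "C j \<in> sets borel"
        unfolding C_def using H(2) borel_pinjD(1)[OF H(1)] by (intro sets.countable_UN image_subsetI Range_borel)
      moreover have "C j \<subseteq> V" using sub[of j] large_sub[OF assms] by simp
      moreover have "\<forall>n. borel_pinj (H (prod_encode (j, n))) \<and> H (prod_encode (j, n)) \<subseteq> Q
          \<and> Domain (H (prod_encode (j, n))) = S \<and> Range (H (prod_encode (j, n))) \<subseteq> C j"
        using H(1-3) unfolding C_def by (intro allI conjI UN_upper) simp_all
      moreover have "\<forall>m n z. z \<in> Range (H (prod_encode (j, m))) \<longrightarrow> z \<in> Range (H (prod_encode (j, n))) \<longrightarrow> m = n"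
        using disj by (metis prod_encode_eq prod.inject)
      ultimately show ?thesis unfolding large_def
        using S by (intro conjI exI[of _ S] exI[of _ "\<lambda>n. H (prod_encode (j, n))"])
    qed
  qed
qed

end

section \<open>Equitable colourings\<close>

text \<open>\<open>H n\<close> is the \<open>n\<close>-th iterate of \<open>\<Phi>\<close> on
  \<open>A\<close>. Two iterates with a common value can be cancelled until one of them is the
  identity; the value then lies in \<open>A\<close>, which \<open>\<Phi>\<close> misses, so the
  exponents agree.\<close>

lemma (in borel_pinj_cover) large_V:
  assumes \<Phi>: "borel_pinj \<Phi>" "\<Phi> \<subseteq> Q" "Domain \<Phi> = V" "Range \<Phi> \<subseteq> V - A"
    and A: "A \<in> sets borel" "A \<subseteq> V" "Q `` A = V"
  shows "large V"
proof -
  define H where "H = (\<lambda>n. ((\<lambda>R. R O \<Phi>) ^^ n) (Id_on A))"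
  have H0: "H 0 = Id_on A" and HS: "H (Suc n) = H n O \<Phi>" for n by (simp_all add: H_def)
  have pinj: "borel_pinj (H n)" for n
    using \<Phi>(1) A(1) by (induction n) (auto simp: H0 HS intro: borel_pinj_relcomp borel_pinj_Id_on)
  have sub: "H n \<subseteq> Q" for n
  proof (induction n)
    case 0
    show ?case unfolding H0 using A(2) Q_refl by auto
  next
    case (Suc n)
    then show ?case unfolding HS using \<Phi>(2) Q_trans by blast
  qed
  have ran: "Range (H n) \<subseteq> V" for n using sub[of n] Q_V by blast
  have dom: "Domain (H n) = A" for n
  proof (induction n)
    case (Suc n)
    have "Range (H n) \<subseteq> Domain \<Phi>" using ran \<Phi>(3) by simp
    then have "Domain (H n O \<Phi>) = Domain (H n)" by blast
    then show ?case using Suc by (simp add: HS)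
  qed (simp add: H0)
  have A0: "n = 0" if "z \<in> A" "z \<in> Range (H n)" for n z
    using that \<Phi>(4) by (cases n) (auto simp: HS)
  have disj: "m = n" if "z \<in> Range (H m)" "z \<in> Range (H n)" for m n z
    using that
  proof (induction m arbitrary: n z)
    case 0
    then have "z \<in> A" by (auto simp: H0)
    then show ?case using A0 0(2) by simp
  next
    case (Suc m)
    then obtain y where y: "y \<in> Range (H m)" "(y, z) \<in> \<Phi>" by (auto simp: HS)
    then have "z \<notin> A" using \<Phi>(4) by auto
    then obtain n' where n': "n = Suc n'" using Suc.prems(2) by (cases n) (auto simp: H0)
    then obtain y' where y': "y' \<in> Range (H n')" "(y', z) \<in> \<Phi>" using Suc.prems(2) by (auto simp: HS)
    have "y' = y" using borel_pinjD(3)[OF \<Phi>(1)] y(2) y'(2) by simp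
    then show ?case using Suc.IH[OF y(1)] y'(1) n' by simp
  qed
  show ?thesis
    unfolding large_def using V_borel A(1,3) pinj sub dom ran disj
    by (intro conjI exI[of _ A] exI[of _ H] allI impI) auto
qed

lemma (in borel_pinj_cover) large_color_classes:
  fixes f :: "'a \<Rightarrow> nat"
  assumes V_large: "large V" and fin: "finite \<G>" and pinjs: "\<forall>J\<in>\<G>. borel_pinj J"
    and E: "E = \<Union>\<G>" "E \<subseteq> Q" "sym E"
    and range: "f ` V \<subseteq> {..<k}" and meas: "\<And>i. {x \<in> V. f x = i} \<in> sets borel"
    and proper_f: "\<forall>(x, y)\<in>E. f x \<noteq> f y"
  shows "\<exists>g :: 'a \<Rightarrow> nat. g ` V \<subseteq> {..<k} \<and> (\<forall>i. {x \<in> V. g x = i} \<in> sets borel)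
    \<and> (\<forall>(x, y)\<in>E. g x \<noteq> g y) \<and> (\<forall>i<k. large {x \<in> V. g x = i})"
proof -
  have pinj: "borel_pinj J" if "J \<in> \<G>" for J using pinjs that by blast
  have proper: "f x \<noteq> f y" if "(x, y) \<in> E" for x y using proper_f that by blast
  have E_sym: "(y, x) \<in> E" if "(x, y) \<in> E" for x y using symD[OF E(3) that] .
  have E_borel: "E \<in> sets borel"
    unfolding E(1) using fin pinj borel_pinjD(1) by (intro sets.finite_Union) auto
  have EV: "x \<in> V \<and> y \<in> V" if "(x, y) \<in> E" for x y using that E(2) Q_V by blast
  define F where "F = (\<lambda>i. {x \<in> V. f x = i})"
  have F_borel: "F i \<in> sets borel" for i unfolding F_def by (rule meas)
  \<comment> \<open>The pigeonhole is applied to restrictions of the identity: \<open>W i\<close>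
    collects components for which colour \<open>i\<close> is chosen, so \<open>I\<close> is
    monochromatic on each component.\<close>
  have Id_F: "borel_pinj (Id_on (F i)) \<and> Id_on (F i) \<subseteq> Q" if "i < k" for i
    using borel_pinj_Id_on[OF F_borel] Q_refl unfolding F_def by auto
  have cover: "V \<subseteq> (\<Union>i<k. Domain (Id_on (F i)))" using range unfolding F_def by auto
  obtain W where W: "\<And>i. W i \<in> sets borel" "\<And>i x y. x \<in> W i \<Longrightarrow> (x, y) \<in> Q \<Longrightarrow> y \<in> W i"
    "\<And>i j x. x \<in> W i \<Longrightarrow> x \<in> W j \<Longrightarrow> i = j" "large (\<Union>i<k. Id_on (F i) `` W i)"
    by (rule large_pigeonhole[OF V_large Id_F cover]) (assumption, rule that)
  define I where "I = (\<Union>i<k. Id_on (F i) `` W i)"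
  have indep: False if xy: "(x, y) \<in> E" "x \<in> I" "y \<in> I" for x y
  proof -
    obtain i where i: "x \<in> W i" "f x = i" using xy(2) unfolding I_def F_def by auto
    obtain j where j: "y \<in> W j" "f y = j" using xy(3) unfolding I_def F_def by auto
    have "y \<in> W i" using W(2)[OF i(1)] xy(1) E(2) by auto
    then have "i = j" using W(3) j(1) by simp
    then show False using proper[OF xy(1)] i j by simp
  qed
  obtain C :: "nat \<Rightarrow> 'a set" where C': "\<forall>j. large (C j) \<and> C j \<subseteq> I" "disjoint_family C"
    using large_split[OF W(4)[folded I_def]] by (elim exE conjE)
  then have C: "large (C j)" "C j \<subseteq> I" "disjoint_family C" for j by simp_all
  define B where "B = (\<lambda>j. C j - E `` F j)"
  have B_borel: "B j \<in> sets borel" for j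
    unfolding B_def using large_borel[OF C(1)] Image_borel[OF E_borel E(2) F_borel] by auto
  have BI: "x \<in> I" if "x \<in> B j" for x j using that C(2)[of j] unfolding B_def by auto
  have BV: "B j \<subseteq> V" for j using large_sub[OF C(1)[of j]] unfolding B_def by auto
  have B_disj: "i = j" if "x \<in> B i" "x \<in> B j" for x i j
    using that C(3) unfolding B_def disjoint_family_on_def by blast
  \<comment> \<open>Only the first \<open>k\<close> pieces are used for recolouring. The
    \<open>THE\<close> is sound because all the \<open>B j\<close> are pairwise disjoint.\<close>
  define g where "g = (\<lambda>x. if \<exists>j<k. x \<in> B j then THE j. x \<in> B j else f x)"
  have gB: "g x = j" if "x \<in> B j" "j < k" for x j
    unfolding g_def using that B_disj by auto
  have gf: "g x = f x" if "\<And>j. j < k \<Longrightarrow> x \<notin> B j" for x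
    unfolding g_def using that by auto
  have g_range: "g ` V \<subseteq> {..<k}"
  proof (rule image_subsetI)
    fix x assume "x \<in> V"
    then show "g x \<in> {..<k}" using gB[of x] gf[of x] range by (cases "\<exists>j<k. x \<in> B j") auto
  qed
  have class_eq: "{x \<in> V. g x = j} = (B j \<union> (F j - (\<Union>i<k. B i)))" if "j < k" for j
  proof (rule set_eqI)
    fix x
    show "x \<in> {x \<in> V. g x = j} \<longleftrightarrow> x \<in> B j \<union> (F j - (\<Union>i<k. B i))"
    proof (cases "\<exists>i<k. x \<in> B i")
      case True
      then obtain i where i: "i < k" "x \<in> B i" by blast
      then have "g x = i" "x \<in> V" using gB BV[of i] by auto
      moreover have "x \<in> B j \<longleftrightarrow> i = j" using i(2) B_disj[of x i j] by blast
      moreover have "x \<in> (\<Union>i<k. B i)" using i by blast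
      ultimately show ?thesis by simp
    next
      case False
      then have "g x = f x" using gf by blast
      then show ?thesis using False that by (auto simp: F_def)
    qed
  qed
  have class_borel: "{x \<in> V. g x = j} \<in> sets borel" for j
  proof (cases "j < k")
    case True
    have "B j \<union> (F j - (\<Union>i<k. B i)) \<in> sets borel" using B_borel F_borel by auto
    then show ?thesis using class_eq[OF True] by simp
  next
    case False
    then have "{x \<in> V. g x = j} = {}" using g_range by auto
    then show ?thesis by (simp only: sets.empty_sets)
  qed
  have g_proper: "g x \<noteq> g y" if xy: "(x, y) \<in> E" for x y
  proof -
    \<comment> \<open>A neighbour \<open>y\<close> of \<open>x \<in> B i\<close> lies outside
      \<open>I\<close>, hence keeps the colour \<open>f y\<close>, and this is not \<open>i\<close>
      because \<open>B i\<close> excludes the neighbours of \<open>F i\<close>.\<close>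
    have half: "g x \<noteq> g y" if xy: "(x, y) \<in> E" "i < k" "x \<in> B i" for x y i
    proof -
      have "y \<notin> I" using indep[OF xy(1) BI[OF xy(3)]] by blast
      then have "g y = f y" using gf BI by blast
      moreover have "y \<notin> F i" using xy(3) E_sym[OF xy(1)] unfolding B_def by blast
      ultimately show ?thesis using gB[OF xy(3,2)] EV[OF xy(1)] by (simp add: F_def)
    qed
    show ?thesis
    proof (cases "\<exists>i<k. x \<in> B i \<or> y \<in> B i")
      case True
      then show ?thesis using half[OF xy] half[OF E_sym[OF xy]] by metis
    next
      case False
      then show ?thesis using gf[of x] gf[of y] proper[OF xy] by metis
    qed
  qed
  have g_large: "large {x \<in> V. g x = j}" if j: "j < k" for j
  proof -
    define U where "U = {x \<in> V. g x = j}"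
    have U_borel: "U \<in> sets borel" unfolding U_def by (rule class_borel)
    obtain Js where Js: "set Js = \<G>" using finite_list[OF fin] by blast
    \<comment> \<open>The closed neighbourhood relation, cut down to targets in \<open>U\<close>:
      index \<open>0\<close> serves points that lie in \<open>U\<close> themselves, index
      \<open>Suc i\<close> those whose neighbour along \<open>Js ! i\<close> is in
      \<open>U\<close>.\<close>
    define R where "R = (\<lambda>i. case i of 0 \<Rightarrow> Id_on U | Suc i \<Rightarrow> Js ! i \<inter> UNIV \<times> U)"
    have R: "borel_pinj (R i) \<and> R i \<subseteq> Q" if i: "i < Suc (length Js)" for i
    proof (cases i)
      case 0
      have "Id_on U \<subseteq> Q" using Q_refl unfolding U_def by auto
      then show ?thesis using borel_pinj_Id_on[OF U_borel] by (simp add: R_def 0)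
    next
      case (Suc l)
      then have "Js ! l \<in> \<G>" using i Js by auto
      then have "borel_pinj (Js ! l)" "Js ! l \<subseteq> Q" using pinj E by auto
      then show ?thesis using U_borel by (auto simp: R_def Suc intro!: borel_pinj_Int borel_Times)
    qed
    have cover: "C j \<subseteq> (\<Union>i<Suc (length Js). Domain (R i))"
    proof
      fix x assume x: "x \<in> C j"
      show "x \<in> (\<Union>i<Suc (length Js). Domain (R i))"
      proof (cases "x \<in> B j")
        case True
        then have "x \<in> U" using gB[OF True j] BV[of j] unfolding U_def by auto
        then have "x \<in> Domain (R 0)" by (auto simp: R_def)
        then show ?thesis by blast
      next
        case False
        then obtain y where y: "(y, x) \<in> E" "y \<in> F j" using x unfolding B_def by blast
        have "y \<notin> I" using indep[OF y(1)] C(2)[of j] x by blast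
        then have "g y = f y" using gf BI by blast
        then have "y \<in> U" using y(2) unfolding U_def F_def by simp
        obtain J where "J \<in> \<G>" "(x, y) \<in> J" using E_sym[OF y(1)] unfolding E(1) by blast
        then obtain l where l: "l < length Js" "(x, y) \<in> Js ! l" using Js by (metis in_set_conv_nth)
        then have "x \<in> Domain (R (Suc l))" using \<open>y \<in> U\<close> by (auto simp: R_def)
        then show ?thesis using l(1) by blast
      qed
    qed
    obtain W' where "\<And>i. W' i \<in> sets borel" "\<And>i x y. x \<in> W' i \<Longrightarrow> (x, y) \<in> Q \<Longrightarrow> y \<in> W' i"
      "\<And>i j x. x \<in> W' i \<Longrightarrow> x \<in> W' j \<Longrightarrow> i = j" and W': "large (\<Union>i<Suc (length Js). R i `` W' i)"
      by (rule large_pigeonhole[OF C(1)[of j] R cover]) (assumption, rule that)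
    have "R i `` X \<subseteq> U" for i X unfolding R_def by (cases i) auto
    then have "(\<Union>i<Suc (length Js). R i `` W' i) \<subseteq> U" by (intro UN_least)
    then show ?thesis using large_mono[OF W' _ _ U_borel] unfolding U_def by auto
  qed
  show ?thesis
    by (intro exI[of _ g] conjI allI impI g_range class_borel g_large) (use g_proper in fast)
qed

section \<open>From the graph to partial injections\<close>

lemma borel_graph_pinj_decomposition:
  assumes G: "borel_graph V E" and deg: "finite_max_degree V E"
  obtains \<G> where "finite \<G>" "\<And>J. J \<in> \<G> \<Longrightarrow> borel_pinj J" "\<Union>\<G> = E"
proof -
  have E: "E \<in> sets borel" "sym E" "E \<subseteq> V \<times> V"
    using G unfolding borel_graph_def borel_prod by auto
  obtain d where d: "\<And>x. x \<in> V \<Longrightarrow> finite (E `` {x}) \<and> card (E `` {x}) \<le> d"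
    using deg unfolding finite_max_degree_def by blast
  have "finite (E `` {x}) \<and> card (E `` {x}) \<le> d" for x
  proof (cases "x \<in> V")
    case False
    then have "E `` {x} = {}" using E(3) by auto
    then show ?thesis by simp
  qed (rule d)
  then obtain \<J> where J: "finite \<J>" "\<forall>J\<in>\<J>. J \<in> sets borel \<and> single_valued J" "\<Union>\<J> = E"
    using borel_single_valued_decomposition[OF E(1)] by metis
  \<comment> \<open>By symmetry \<open>E\<close> is also the union of the converses of the members
    of \<open>\<J>\<close>; the intersection of a member with such a converse is single-valued in
    both directions.\<close>
  define \<G> where "\<G> = (\<lambda>(J, K). J \<inter> K\<inverse>) ` (\<J> \<times> \<J>)"
  show ?thesis
  proof (rule that[of \<G>])
    show "finite \<G>" unfolding \<G>_def using J(1) by simp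
    show "borel_pinj P" if P: "P \<in> \<G>" for P
    proof -
      from P obtain J' K where "J' \<in> \<J>" "K \<in> \<J>" "P = J' \<inter> K\<inverse>" unfolding \<G>_def by auto
      then show ?thesis
        using J(2) borel_converse[of K] unfolding borel_pinj_def single_valued_def by auto
    qed
    show "\<Union>\<G> = E"
    proof (intro equalityI subrelI)
      fix x y assume "(x, y) \<in> E"
      then obtain J' K where "J' \<in> \<J>" "K \<in> \<J>" "(x, y) \<in> J'" "(y, x) \<in> K"
        using symD[OF E(2)] J(3) by (metis UnionE)
      then show "(x, y) \<in> \<Union>\<G>" unfolding \<G>_def by auto
    qed (use J(3) in \<open>auto simp: \<G>_def\<close>)
  qed
qed

text \<open>Paths follow words in the finitely many generators, and there are only countably many
  words.\<close>

lemma borel_graph_pinj_cover: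
  assumes V: "V \<in> sets borel" and fin: "finite \<G>" and pinj: "\<And>J. J \<in> \<G> \<Longrightarrow> borel_pinj J"
    and E: "\<Union>\<G> = E" "E \<subseteq> V \<times> V" "sym E"
  obtains G where "borel_pinj_cover V (E\<^sup>* \<inter> V \<times> V) G"
proof -
  \<comment> \<open>The final \<open>Id_on V\<close> makes the empty word the diagonal of
    \<open>V\<close>. Since \<open>E\<^sup>*\<close> contains the diagonal of the whole type, it is
    cut down to \<open>V \<times> V\<close>.\<close>
  define P where "P = (\<lambda>w. foldr (O) w (Id_on V))"
  define \<Q> where "\<Q> = P ` lists \<G>"
  have "countable \<Q>" unfolding \<Q>_def using fin by (intro countable_image countable_lists countable_finite)
  have "P [] \<in> \<Q>" unfolding \<Q>_def by (intro imageI) simp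
  define G where "G = from_nat_into \<Q>"
  have G_range: "range G = \<Q>"
    unfolding G_def using \<open>countable \<Q>\<close> \<open>P [] \<in> \<Q>\<close> by (intro range_from_nat_into) auto
  have P_pinj: "borel_pinj (P w)" if "w \<in> lists \<G>" for w
    using that by induction (simp_all add: P_def borel_pinj_Id_on V borel_pinj_relcomp pinj)
  have P_sub: "P w \<subseteq> E\<^sup>* \<inter> V \<times> V" if "w \<in> lists \<G>" for w
    using that
  proof induction
    case Nil
    then show ?case by (auto simp: P_def)
  next
    case (Cons J w)
    show ?case
    proof (rule subrelI)
      fix x y assume "(x, y) \<in> P (J # w)"
      then obtain z where z: "(x, z) \<in> J" "(z, y) \<in> P w" by (auto simp: P_def)
      then have "(x, z) \<in> E" using Cons.hyps(1) E(1) by blast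
      moreover have "(z, y) \<in> E\<^sup>*" "y \<in> V" using Cons.IH z(2) by auto
      ultimately show "(x, y) \<in> E\<^sup>* \<inter> V \<times> V"
        using E(2) by (auto intro: converse_rtrancl_into_rtrancl)
    qed
  qed
  have P_ex: "\<exists>w\<in>lists \<G>. (x, y) \<in> P w" if "(x, y) \<in> E\<^sup>*" "y \<in> V" for x y
    using that
  proof (induction rule: converse_rtrancl_induct)
    case base
    then have "(y, y) \<in> P []" by (auto simp: P_def)
    then show ?case by blast
  next
    case (step x z)
    then obtain w where w: "w \<in> lists \<G>" "(z, y) \<in> P w" by blast
    obtain J where "J \<in> \<G>" "(x, z) \<in> J" using step.hyps(1) E(1) by blast
    then have "J # w \<in> lists \<G>" "(x, y) \<in> P (J # w)" using w by (auto simp: P_def)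
    then show ?case by blast
  qed
  have "E\<^sup>* \<inter> V \<times> V = \<Union>\<Q>"
  proof (intro equalityI subrelI)
    fix x y assume "(x, y) \<in> E\<^sup>* \<inter> V \<times> V"
    then obtain w where "w \<in> lists \<G>" "(x, y) \<in> P w" using P_ex[of x y] by auto
    then show "(x, y) \<in> \<Union>\<Q>" unfolding \<Q>_def by blast
  next
    fix x y assume "(x, y) \<in> \<Union>\<Q>"
    then obtain w where "w \<in> lists \<G>" "(x, y) \<in> P w" unfolding \<Q>_def by blast
    then show "(x, y) \<in> E\<^sup>* \<inter> V \<times> V" using P_sub[of w] by blast
  qed
  then have "E\<^sup>* \<inter> V \<times> V = (\<Union>n. G n)" using G_range by simp
  moreover have "borel_pinj (G n)" for n
    using G_range P_pinj unfolding \<Q>_def by (metis imageE rangeI)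
  moreover have "equiv V (E\<^sup>* \<inter> V \<times> V)"
    using sym_rtrancl[OF E(3)]
    by (intro equivI) (auto simp: refl_on_def sym_def intro!: transI intro: rtrancl_trans)
  ultimately have "borel_pinj_cover V (E\<^sup>* \<inter> V \<times> V) G"
    by unfold_locales (use V in auto)
  then show ?thesis by (rule that)
qed

lemma borel_pinj_graph_of_map:
  fixes V :: "'a::polish_space set"
  assumes V: "V \<in> sets borel" and \<phi>: "\<phi> \<in> measurable (restrict_space borel V) borel" and inj: "inj_on \<phi> V"
  shows "borel_pinj {(x, \<phi> x) | x. x \<in> V}"
proof -
  \<comment> \<open>\<open>\<phi>\<close> is controlled on \<open>V\<close> only; the identity
    extends it to a Borel map on the whole space, the form in which Lusin--Souslin is
    applied.\<close>
  define \<psi> where "\<psi> = (\<lambda>x. if x \<in> V then \<phi> x else x)"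
  have [measurable]: "\<psi> \<in> borel_measurable borel"
    unfolding \<psi>_def using V \<phi>
    by (subst measurable_If_restrict_space_iff) (auto intro: measurable_restrict_space1)
  have "(\<lambda>x. (x, \<psi> x)) \<in> borel_measurable borel"
    using borel_measurable_Pair by measurable
  then have "(\<lambda>x. (x, \<psi> x)) ` V \<in> sets borel"
    using V by (rule borel_inj_image) (simp add: inj_on_def)
  moreover have "(\<lambda>x. (x, \<psi> x)) ` V = {(x, \<phi> x) | x. x \<in> V}" unfolding \<psi>_def by auto
  ultimately show ?thesis
    using inj by (intro borel_pinjI) (auto simp: inj_on_def)
qed

theorem theorem3p14:
  fixes V :: "'a::polish_space set" and E :: "('a \<times> 'a) set" and k :: nat
  assumes "borel_graph V E"
    and "compressible V E"
    and "finite_max_degree V E"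
    and "\<exists>f. borel_proper_coloring V E k f"
  shows "\<exists>g. borel_equitable_coloring V E k g"
proof -
  have V: "V \<in> sets borel" and E: "E \<subseteq> V \<times> V" "sym E"
    using assms(1) by (auto simp: borel_graph_def)
  obtain \<G> where \<G>: "finite \<G>" "\<And>J. J \<in> \<G> \<Longrightarrow> borel_pinj J" "\<Union>\<G> = E"
    using borel_graph_pinj_decomposition[OF assms(1,3)] by metis
  have pinjs: "\<forall>J\<in>\<G>. borel_pinj J" using \<G>(2) by simp
  define Q where "Q = E\<^sup>* \<inter> V \<times> V"
  obtain G where "borel_pinj_cover V Q G"
    using borel_graph_pinj_cover[OF V \<G> E] unfolding Q_def by metis
  then interpret borel_pinj_cover V Q G .
  have E_Q: "E \<subseteq> Q" unfolding Q_def using E(1) by auto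
  obtain A where A: "A \<in> sets borel" "A \<subseteq> V" "saturation V E A = saturation V E V" "borel_equidec E V (V - A)"
    using assms(2) unfolding compressible_def compressible_set_def by blast
  then obtain \<phi> where \<phi>: "bij_betw \<phi> V (V - A)"
    "\<phi> \<in> measurable (restrict_space borel V) (restrict_space borel (V - A))" "\<And>x. x \<in> V \<Longrightarrow> same_comp E x (\<phi> x)"
    unfolding borel_equidec_def by blast
  have \<phi>V: "\<phi> x \<in> V - A" if "x \<in> V" for x using bij_betwE[OF \<phi>(1)] that by blast
  have "large V"
  proof (rule large_V)
    have "\<phi> \<in> measurable (restrict_space borel V) borel"
      using \<phi>(2) by (simp add: measurable_restrict_space2_iff)
    then show "borel_pinj {(x, \<phi> x) | x. x \<in> V}"
      using V \<phi>(1) by (intro borel_pinj_graph_of_map) (auto simp: bij_betw_def)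
    show "{(x, \<phi> x) | x. x \<in> V} \<subseteq> Q"
      using \<phi>(3) \<phi>V unfolding same_comp_def Q_def by auto
    show "Domain {(x, \<phi> x) | x. x \<in> V} = V" by auto
    show "Range {(x, \<phi> x) | x. x \<in> V} \<subseteq> V - A" using \<phi>V by auto
    show "Q `` A = V"
    proof -
      have "saturation V E V = V" unfolding saturation_def same_comp_def by auto
      moreover have "saturation V E A = Q `` A"
        using A(2) unfolding saturation_def same_comp_def Q_def by auto
      ultimately show ?thesis using A(3) by simp
    qed
  qed (use A in auto)
  obtain f where f: "f ` V \<subseteq> {..<k}" "f \<in> measurable (restrict_space borel V) (count_space UNIV)"
    "\<forall>(x, y)\<in>E. f x \<noteq> f y"
    using assms(4) unfolding borel_proper_coloring_def by blast
  have f_class: "{x \<in> V. f x = i} \<in> sets borel" for i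
  proof -
    have "f -` {i} \<inter> space (restrict_space borel V) \<in> sets (restrict_space borel V)"
      using f(2) by (rule measurable_sets) simp
    moreover have "f -` {i} \<inter> space (restrict_space borel V) = {x \<in> V. f x = i}"
      by (auto simp: space_restrict_space)
    ultimately show ?thesis using V by (simp add: sets_restrict_space_iff)
  qed
  obtain g :: "'a \<Rightarrow> nat" where g: "g ` V \<subseteq> {..<k}" "\<forall>i. {x \<in> V. g x = i} \<in> sets borel"
    "\<forall>(x, y)\<in>E. g x \<noteq> g y" "\<forall>i<k. large {x \<in> V. g x = i}"
    using large_color_classes[OF \<open>large V\<close> \<G>(1) pinjs \<G>(3)[symmetric] E_Q E(2) f(1) f_class f(3)]
    by (elim exE conjE)
  have "g \<in> measurable (restrict_space borel V) (count_space UNIV)"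
  proof (subst measurable_count_space_eq2_countable)
    have "g -` {i} \<inter> space (restrict_space borel V) = {x \<in> V. g x = i}" for i
      by (auto simp: space_restrict_space)
    then show "g \<in> space (restrict_space borel V) \<rightarrow> UNIV \<and>
        (\<forall>i\<in>UNIV. g -` {i} \<inter> space (restrict_space borel V) \<in> sets (restrict_space borel V))"
      using V g(2) by (simp add: sets_restrict_space_iff)
  qed
  then have "borel_proper_coloring V E k g"
    using g(1,3) unfolding borel_proper_coloring_def by blast
  moreover have "borel_equidec E {x \<in> V. g x = \<alpha>} {x \<in> V. g x = \<beta>}" if \<alpha>\<beta>: "\<alpha> < k" "\<beta> < k" for \<alpha> \<beta>
  proof -
    obtain \<theta> where \<theta>: "borel_pinj \<theta>" "\<theta> \<subseteq> Q" "Domain \<theta> = V" "Range \<theta> = {x \<in> V. g x = \<alpha>}"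
      using large_imp_bijection[OF g(4)[rule_format, OF \<alpha>\<beta>(1)]] by metis
    obtain \<eta> where \<eta>: "borel_pinj \<eta>" "\<eta> \<subseteq> Q" "Domain \<eta> = V" "Range \<eta> = {x \<in> V. g x = \<beta>}"
      using large_imp_bijection[OF g(4)[rule_format, OF \<alpha>\<beta>(2)]] by metis
    \<comment> \<open>Both classes are matched with all of \<open>V\<close>, so they are matched
      with each other: back along \<open>\<theta>\<close>, then forward along
      \<open>\<eta>\<close>.\<close>
    have "Domain (\<theta>\<inverse> O \<eta>) = Range \<theta>" "Range (\<theta>\<inverse> O \<eta>) = Range \<eta>"
      using \<theta>(3) \<eta>(3) by blast+
    moreover have "\<theta>\<inverse> O \<eta> \<subseteq> E\<^sup>*"
      using \<theta>(2) \<eta>(2) Q_sym Q_trans unfolding Q_def by blast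
    ultimately show ?thesis
      using borel_equidec_of_pinj[OF borel_pinj_relcomp[OF borel_pinj_converse[OF \<theta>(1)] \<eta>(1)]] \<theta>(4) \<eta>(4)
      by metis
  qed
  ultimately show ?thesis unfolding borel_equitable_coloring_def by blast
qed

end
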